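(* Let $p\in(0,1)$ and let $(\sigma_i)_{i\ge 1}$ be i.i.d. random variables with values in $\{-1,+1\}$ and $\mathbb P_p(\sigma_i=+1)=p$, $\mathbb P_p(\sigma_i=-1)=1-p$. Let $\mathbb E_p$ denote expectation under $\mathbb P_p$, and for $N\ge 1$ let $$S_N=\sum_{i=1}^N \sigma_i\sigma_{2i}.$$ Let $\mathcal F_p:\mathbb R\to\mathbb R$ be the explicit function defined in the context. Then: 1. (Large deviations.) The sequence of random variables $S_N/N$ satisfies, as $N\to\infty$, a large deviation principle with speed $N$ and rate function $$I_p(x)=\sup_{\lambda\in\mathbb R}\left(\lambda x-\mathcal F_p(\lambda)\right),\qquad x\in\mathbb R.$$ 2. (Central limit theorem.) As $N\to\infty$, the sequence of random variables $$N^{-1/2}\left(S_N-\mathbb E_p(S_N)\right)$$ converges weakly to a centered Gaussian random variable with variance $\mathcal F_p''(0)$, and this variance is strictly positive: $\mathcal F_p''(0)>0$.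
   Context: Definition of $\mathcal F_p$. Fix $p\in(0,1)$ and set $h=\frac12\log\frac{p}{1-p}$. For $\lambda\in\mathbb R$ let $$\Lambda_\pm=\Lambda_\pm(\lambda)=e^{\lambda}\left(\cosh(h)\pm\sqrt{\sinh^2(h)+e^{-4\lambda}}\right),$$ which are the largest ($+$) and smallest ($-$) eigenvalues of the symmetric $2\times 2$ matrix $M$ indexed by $\alpha,\beta\in\{+1,-1\}$ with entries $M_{\alpha,\beta}=e^{\lambda\alpha\beta+\frac h2(\alpha+\beta)}$. Let $$v=\begin{pmatrix}e^{h/2}\\ e^{-h/2}\end{pmatrix},\qquad w_+=\begin{pmatrix}-e^{-\lambda}\\ e^{h+\lambda}-\Lambda_+\end{pmatrix},\qquad e_+=\frac{w_+}{\|w_+\|},$$ where $\|\cdot\|$ is the Euclidean norm, so that $e_+$ is a normalized eigenvector of $M$ for the eigenvalue $\Lambda_+$. Write $v^T\cdot e_+$ for the Euclidean inner product of $v$ and $e_+$. Then $$\mathcal F_p(\lambda)=\log\left([p(1-p)]^{3/4}\,|v^T\cdot e_+|\,\Lambda_+\right)+\mathcal G(\lambda),$$ $$\mathcal G(\lambda)=\frac12\sum_{n=1}^\infty\frac1{2^n}\log\left(1+\left(\frac{2\cosh(h)}{|v^T\cdot e_+|^2}-1\right)\left(\frac{\Lambda_-}{\Lambda_+}\right)^n\right).$$ Large deviation principle with speed $N$ and rate function $I$ for real random variables $Y_N$ has its usual meaning: $I:\mathbb R\to[0,\infty]$ is lower semicontinuous, $\limsup_N \frac1N\log\mathbb P(Y_N\in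 F)\le-\inf_F I$ for every closed $F\subset\mathbb R$, and $\liminf_N\frac1N\log\mathbb P(Y_N\in G)\ge-\inf_G I$ for every open $G\subset\mathbb R$. *)

theory Defs
  imports "HOL-Probability.Probability"
begin

definition field_h :: "real \<Rightarrow> real" where
  "field_h p = 1/2 * ln (p / (1 - p))"

definition Lambda_plus :: "real \<Rightarrow> real \<Rightarrow> real" where
  "Lambda_plus p l =
     exp l * (cosh (field_h p) + sqrt ((sinh (field_h p))\<^sup>2 + exp (- 4 * l)))"

definition Lambda_minus :: "real \<Rightarrow> real \<Rightarrow> real" where
  "Lambda_minus p l =
     exp l * (cosh (field_h p) - sqrt ((sinh (field_h p))\<^sup>2 + exp (- 4 * l)))"

definition vec_v :: "real \<Rightarrow> real ^ 2" where
  "vec_v p = vector [exp (field_h p / 2), exp (- field_h p / 2)]"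

definition vec_w_plus :: "real \<Rightarrow> real \<Rightarrow> real ^ 2" where
  "vec_w_plus p l = vector [- exp (- l), exp (field_h p + l) - Lambda_plus p l]"

definition vec_e_plus :: "real \<Rightarrow> real \<Rightarrow> real ^ 2" where
  "vec_e_plus p l = vec_w_plus p l /\<^sub>R norm (vec_w_plus p l)"

text \<open>
  The sum runs over \<open>n \<ge> 1\<close>, hence the shifted index \<open>Suc n\<close>.
\<close>

definition cal_G :: "real \<Rightarrow> real \<Rightarrow> real" where
  "cal_G p l = 1/2 * (\<Sum>n. 1 / 2 ^ Suc n *
     ln (1 + (2 * cosh (field_h p) / \<bar>vec_v p \<bullet> vec_e_plus p l\<bar>\<^sup>2 - 1)
               * (Lambda_minus p l / Lambda_plus p l) ^ Suc n))"

definition cal_F :: "real \<Rightarrow> real \<Rightarrow> real" where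
  "cal_F p l =
     ln ((p * (1 - p)) powr (3/4) * \<bar>vec_v p \<bullet> vec_e_plus p l\<bar> * Lambda_plus p l)
     + cal_G p l"

text \<open>
  The supremum is taken in the extended reals, since it is infinite for some \<open>x\<close>.
\<close>

definition rate_I :: "real \<Rightarrow> real \<Rightarrow> ereal" where
  "rate_I p x = (SUP l::real. ereal (l * x - cal_F p l))"

definition S_sum :: "(nat \<Rightarrow> 'a \<Rightarrow> real) \<Rightarrow> nat \<Rightarrow> 'a \<Rightarrow> real" where
  "S_sum \<sigma> N \<omega> = (\<Sum>i=1..N. \<sigma> i \<omega> * \<sigma> (2 * i) \<omega>)"

text \<open>
  Logarithm of a probability, with \<open>log 0 = -\<infinity>\<close> (the library's \<open>ln 0\<close> is \<open>0\<close>).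
\<close>

definition elog :: "real \<Rightarrow> ereal" where
  "elog x = (if x = 0 then - \<infinity> else ereal (ln x))"

definition lower_semicont :: "(real \<Rightarrow> ereal) \<Rightarrow> bool" where
  "lower_semicont f \<longleftrightarrow> (\<forall>x. f x \<le> Liminf (at x) f)"

text \<open>
  Large deviation principle with speed \<open>N\<close>; infima over the empty set are \<open>\<infinity>\<close>.
\<close>

definition LDP :: "'a measure \<Rightarrow> (nat \<Rightarrow> 'a \<Rightarrow> real) \<Rightarrow> (real \<Rightarrow> ereal) \<Rightarrow> bool" where
  "LDP M Y I \<longleftrightarrow>
     (\<forall>N. Y N \<in> borel_measurable M) \<and>
     (\<forall>x. 0 \<le> I x) \<and> lower_semicont I \<and>
     (\<forall>F. closed F \<longrightarrow>
        limsup (\<lambda>N. ereal (1 / real N) * elog (measure M {\<omega> \<in> space M. Y N \<omega> \<in> F}))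
          \<le> - (INF x\<in>F. I x)) \<and>
     (\<forall>G. open G \<longrightarrow>
        liminf (\<lambda>N. ereal (1 / real N) * elog (measure M {\<omega> \<in> space M. Y N \<omega> \<in> G}))
          \<ge> - (INF x\<in>G. I x))"

end

theory Submission
  imports Defs
begin

text \<open>
  Multiplication by 2 splits the sites into chains \<open>k, 2k, 4k, \<dots>\<close> with \<open>k\<close> odd, and \<open>S\<^sub>N\<close> is a sum of
  independent open Ising chains: about \<open>N / 2\<^bsup>n+1\<^esup>\<close> of them have \<open>n\<close> bonds. Hence the scaled
  cumulant generating function of \<open>S\<^sub>N\<close> tends to \<open>\<Sum>\<^sub>n 2\<^bsup>-(n+1)\<^esup> K\<^sub>n\<close>, where \<open>K\<^sub>n\<close> is the cumulant
  generating function of a chain with \<open>n\<close> bonds; diagonalising the transfer matrix identifies this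
  series with \<open>cal_F p\<close>. As \<open>\<bar>K\<^sub>n'\<bar> \<le> n\<close> and \<open>\<bar>K\<^sub>n''\<bar> \<le> n\<^sup>2\<close>, it can be differentiated
  twice term by term. Differentiability gives the large deviation principle by the Gaertner-Ellis
  argument, and the second derivative at 0 is the limit of \<open>Var(S\<^sub>N) / N\<close>. The central limit theorem
  follows from a third-order expansion of the characteristic functions of the chains, because the
  chains have a bounded average cubed length.
\<close>

section \<open>The Gaertner-Ellis theorem for bounded variables\<close>

text \<open>The weights \<open>1 / 2 ^ (n + 1)\<close> come from counting: a chain has exactly
  \<open>n\<close> bonds when its odd starting point lies in the interval from
  \<open>N / 2 ^ n\<close> (excluded) to \<open>N / 2 ^ (n - 1)\<close> (included), and half of the
  integers there are odd. The obstacle is that chain lengths are unequal and grow with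
  \<open>N\<close>, so the chains form a triangular array of non-identical variables. Since the
  share of chains with \<open>n\<close> bonds decays geometrically, every average of a polynomially
  bounded function of the length converges; the single statement
  \<open>chain_average_tendsto\<close> serves the cumulant generating function, the variance and the
  error terms of the central limit theorem. The closed form of \<open>cal_F\<close> contains square
  roots and powers of an eigenvalue ratio whose sign depends on the parameter. It is used only to
  recognise the sum of the series. Derivatives and the positivity of the variance are read off from
  the series of chain cumulants, where they have a probabilistic meaning.\<close>

lemma limsup_elog_le:
  assumes "eventually (\<lambda>N. P N \<le> c * exp (- (real N * m))) sequentially"
    and "c > 0" and nonneg: "\<And>N. 0 \<le> P N"
  shows "limsup (\<lambda>N. ereal (1 / real N) * elog (P N)) \<le> ereal (- m)"
proof -
  have "eventually (\<lambda>N. ereal (1 / real N) * elog (P N) \<le> ereal (ln c / real N - m)) sequentially"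
    using assms(1) eventually_gt_at_top[of 0]
  proof eventually_elim
    case (elim N)
    show ?case
    proof (cases "P N = 0")
      case True
      then show ?thesis using elim by (simp add: elog_def)
    next
      case False
      then have "0 < P N" using nonneg[of N] by simp
      then have "ln (P N) \<le> ln (c * exp (- (real N * m)))"
        using elim by simp
      also have "\<dots> = ln c - real N * m" using \<open>c > 0\<close> by (simp add: ln_mult)
      finally have "ln (P N) / real N \<le> (ln c - real N * m) / real N"
        by (intro divide_right_mono) auto
      then show ?thesis using False elim by (simp add: elog_def field_simps)
    qed
  qed
  then have "limsup (\<lambda>N. ereal (1 / real N) * elog (P N)) \<le> limsup (\<lambda>N. ereal (ln c / real N - m))"
    by (rule Limsup_mono)
  also have "(\<lambda>N. ln c / real N - m) \<longlonglongrightarrow> 0 - m"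
    by (intro tendsto_intros)
  then have "limsup (\<lambda>N. ereal (ln c / real N - m)) = ereal (0 - m)"
    by (intro lim_imp_Limsup tendsto_ereal) auto
  finally show ?thesis by simp
qed

lemma liminf_elog_ge:
  assumes "eventually (\<lambda>N. c * exp (real N * a) \<le> P N) sequentially" and "c > 0"
  shows "ereal a \<le> liminf (\<lambda>N. ereal (1 / real N) * elog (P N))"
proof -
  have "(\<lambda>N. ln c / real N + a) \<longlonglongrightarrow> 0 + a"
    by (intro tendsto_intros)
  then have "liminf (\<lambda>N. ereal (ln c / real N + a)) = ereal (0 + a)"
    by (intro lim_imp_Liminf tendsto_ereal) auto
  then have "ereal a = liminf (\<lambda>N. ereal (ln c / real N + a))" by simp
  also have "eventually (\<lambda>N. ereal (ln c / real N + a) \<le> ereal (1 / real N) * elog (P N)) sequentially"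
    using assms(1) eventually_gt_at_top[of 0]
  proof eventually_elim
    case (elim N)
    have pos: "0 < c * exp (real N * a)" using \<open>c > 0\<close> by simp
    then have "ln (c * exp (real N * a)) \<le> ln (P N)"
      using elim by simp
    also have "ln (c * exp (real N * a)) = ln c + real N * a" using \<open>c > 0\<close> by (simp add: ln_mult)
    finally have "(ln c + real N * a) / real N \<le> ln (P N) / real N"
      by (intro divide_right_mono) auto
    moreover have "P N \<noteq> 0" using pos elim by linarith
    ultimately show ?case using elim by (simp add: elog_def field_simps)
  qed
  then have "liminf (\<lambda>N. ereal (ln c / real N + a)) \<le> liminf (\<lambda>N. ereal (1 / real N) * elog (P N))"
    by (rule Liminf_mono)
  finally show ?thesis .
qed

section \<open>Legendre transforms and exposed points\<close>

definition legendre :: "(real \<Rightarrow> real) \<Rightarrow> real \<Rightarrow> ereal" where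
  "legendre F x = (SUP l::real. ereal (l * x - F l))"

lemma legendre_ge: "ereal (l * x - F l) \<le> legendre F x"
  unfolding legendre_def by (rule SUP_upper) simp

text \<open>Each affine function \<open>l * x - F l\<close> is continuous and lies below the
  supremum, so its value at \<open>x\<close> is a lower bound for the \<open>Liminf\<close>.\<close>

lemma lower_semicont_legendre: "lower_semicont (legendre F)"
  unfolding lower_semicont_def
proof
  fix x
  have "ereal (l * x - F l) \<le> Liminf (at x) (legendre F)" for l
  proof -
    have "((\<lambda>x. l * x - F l) \<longlongrightarrow> l * x - F l) (at x)"
      by (intro tendsto_intros)
    then have "ereal (l * x - F l) = Liminf (at x) (\<lambda>x. ereal (l * x - F l))"
      by (intro lim_imp_Liminf[symmetric] tendsto_ereal) auto
    also have "\<dots> \<le> Liminf (at x) (legendre F)"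
      by (intro Liminf_mono always_eventually allI legendre_ge)
    finally show ?thesis .
  qed
  then show "legendre F x \<le> Liminf (at x) (legendre F)"
    unfolding legendre_def[of F x] by (intro SUP_least)
qed

text \<open>Maximising \<open>l x - F l - \<delta> l\<^sup>2\<close> instead of \<open>l x - F l\<close> makes the maximum attained, and it
  moves the exposed point \<open>F' l\<close> only slightly away from \<open>x\<close>; no convexity is needed.\<close>

lemma legendre_exposed_point:
  fixes F :: "real \<Rightarrow> real"
  assumes diff: "\<And>l. F differentiable (at l)" and F0: "F 0 = 0"
    and fin: "\<And>l. l * x - F l \<le> r" and "\<epsilon> > 0"
  obtains l y where "(F has_field_derivative y) (at l)" "\<bar>y - x\<bar> < \<epsilon>" "l * y - F l \<le> r"
proof -
  have r: "0 \<le> r" using fin[of 0] F0 by simp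
  \<comment> \<open>At a maximiser the derivative condition gives
    \<open>y - x = - 2 * \<delta> * l\<close>, and \<open>\<delta>\<close> times the square of
    \<open>l\<close> is at most \<open>r\<close>. Hence the square of \<open>y - x\<close> is at
    most \<open>4 * \<delta> * r\<close>, which this choice puts below the square of
    \<open>\<epsilon>\<close>; the \<open>+ 1\<close> covers \<open>r = 0\<close>.\<close>
  define \<delta> where "\<delta> = \<epsilon>\<^sup>2 / (8 * (r + 1))"
  have \<delta>: "\<delta> > 0" using r \<open>\<epsilon> > 0\<close> by (simp add: \<delta>_def)
  define g where "g l = l * x - F l - \<delta> * l\<^sup>2" for l
  \<comment> \<open>Outside \<open>{-R..R}\<close> the penalty alone exceeds \<open>r\<close>, so
    \<open>g\<close> is negative there, below \<open>g 0 = 0\<close>. A maximum over the compact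
    interval is therefore global.\<close>
  define R where "R = sqrt (r / \<delta>) + 1"
  have Rpos: "R > 0" using r \<delta> unfolding R_def by (intro add_nonneg_pos) auto
  have contF: "continuous_on UNIV F"
    using diff by (simp add: differentiable_imp_continuous_within continuous_at_imp_continuous_on)
  have "continuous_on {-R..R} g"
    unfolding g_def by (intro continuous_intros continuous_on_subset[OF contF]) auto
  then obtain l where l: "l \<in> {-R..R}" "\<And>y. y \<in> {-R..R} \<Longrightarrow> g y \<le> g l"
    using continuous_attains_sup[of "{-R..R}" g] Rpos by auto
  have g0: "g 0 = 0" by (simp add: g_def F0)
  have gl: "0 \<le> g l" using l(2)[of 0] g0 Rpos by auto
  have max: "g y \<le> g l" for y
  proof (cases "y \<in> {-R..R}")
    case False
    then have "\<bar>y\<bar> > R" by auto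
    then have "y\<^sup>2 > R\<^sup>2" using Rpos by (metis abs_of_pos power2_abs power_strict_mono abs_ge_zero less_imp_le pos2)
    moreover have "R\<^sup>2 \<ge> (sqrt (r / \<delta>))\<^sup>2" unfolding R_def using r \<delta>
      by (intro power_mono) auto
    ultimately have "y\<^sup>2 > r / \<delta>" using r \<delta> by simp
    then have "\<delta> * y\<^sup>2 > r" using \<delta> by (simp add: field_simps)
    then have "g y < 0" using fin[of y] by (simp add: g_def)
    then show ?thesis using gl by simp
  qed (use l in auto)
  obtain y where y: "(F has_field_derivative y) (at l)"
    using diff[of l] by (metis real_differentiable_def)
  have "(g has_field_derivative (x - y - \<delta> * (2 * l))) (at l)"
    unfolding g_def by (auto intro!: derivative_eq_intros y)
  then have "x - y - \<delta> * (2 * l) = 0"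
    by (rule DERIV_local_max[of _ _ _ 1]) (use max in auto)
  then have yx: "y = x - 2 * \<delta> * l" by simp
  have "\<delta> * l\<^sup>2 \<le> r" using gl fin[of l] by (simp add: g_def)
  then have "\<delta> * (\<delta> * l\<^sup>2) \<le> \<delta> * r" using \<delta> by (intro mult_left_mono) auto
  then have "(y - x)\<^sup>2 \<le> 4 * \<delta> * r" by (simp add: yx power2_eq_square algebra_simps)
  also have "\<dots> < \<epsilon>\<^sup>2" using r \<open>\<epsilon> > 0\<close> unfolding \<delta>_def by (simp add: field_simps add_pos_nonneg)
  finally have "\<bar>y - x\<bar> < \<epsilon>" using \<open>\<epsilon> > 0\<close>
    using power_less_imp_less_base[of "\<bar>y - x\<bar>" 2 \<epsilon>] by simp
  moreover have "l * y - F l \<le> r"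
  proof -
    have "l * y - F l = l * x - F l - 2 * (\<delta> * l\<^sup>2)"
      by (simp add: yx power2_eq_square algebra_simps)
    moreover have "0 \<le> \<delta> * l\<^sup>2" using \<delta> by simp
    ultimately show ?thesis using fin[of l] by linarith
  qed
  ultimately show ?thesis using that y by blast
qed

text \<open>The uniform bound \<open>B\<close> plays the part of exponential tightness: it makes all
  exponential moments finite and reduces closed sets to compact ones.\<close>

locale scaled_cgf_limit = prob_space +
  fixes Y :: "nat \<Rightarrow> 'a \<Rightarrow> real" and B :: real and F :: "real \<Rightarrow> real"
  assumes Y_measurable[measurable]: "\<And>N. Y N \<in> borel_measurable M"
    and Y_bounded: "\<And>N \<omega>. \<omega> \<in> space M \<Longrightarrow> \<bar>Y N \<omega>\<bar> \<le> B"
    and cgf_limit: "\<And>l. (\<lambda>N. ln (expectation (\<lambda>\<omega>. exp (l * (real N * Y N \<omega>)))) / real N) \<longlonglongrightarrow> F l"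
begin

definition Z :: "nat \<Rightarrow> real \<Rightarrow> real" where
  "Z N l = expectation (\<lambda>\<omega>. exp (l * (real N * Y N \<omega>)))"

lemma integrable_exp_tilt [simp, intro]: "integrable M (\<lambda>\<omega>. exp (l * (real N * Y N \<omega>)))"
proof (rule integrable_const_bound[where B = "exp (\<bar>l\<bar> * (real N * B))"])
  show "AE \<omega> in M. norm (exp (l * (real N * Y N \<omega>))) \<le> exp (\<bar>l\<bar> * (real N * B))"
  proof (rule AE_I2)
    fix \<omega> assume "\<omega> \<in> space M"
    have "l * (real N * Y N \<omega>) \<le> \<bar>l * (real N * Y N \<omega>)\<bar>" by simp
    also have "\<dots> = \<bar>l\<bar> * (real N * \<bar>Y N \<omega>\<bar>)" by (simp add: abs_mult)
    also have "\<dots> \<le> \<bar>l\<bar> * (real N * B)"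
      using Y_bounded[OF \<open>\<omega> \<in> space M\<close>] by (intro mult_left_mono) auto
    finally show "norm (exp (l * (real N * Y N \<omega>))) \<le> exp (\<bar>l\<bar> * (real N * B))" by simp
  qed
qed simp

lemma integrable_indicator_tilt:
  assumes "A \<in> sets M"
  shows "integrable M (\<lambda>\<omega>. indicator A \<omega> * exp (l * (real N * Y N \<omega>)))"
  using integrable_real_mult_indicator[OF assms integrable_exp_tilt[of l N]]
  by (simp only: mult.commute)

lemma Z_pos: "0 < Z N l"
proof -
  have "0 \<le> Z N l" unfolding Z_def by (intro integral_nonneg_AE) auto
  moreover have "Z N l \<noteq> 0"
  proof
    assume "Z N l = 0"
    then have "AE \<omega> in M. exp (l * (real N * Y N \<omega>)) = 0"
      unfolding Z_def by (subst (asm) integral_nonneg_eq_0_iff_AE) auto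
    then show False using not_AE_zero_E by (auto simp: prob_space)
  qed
  ultimately show ?thesis by simp
qed

lemma eventually_Z_le:
  assumes "a > F l"
  shows "eventually (\<lambda>N. Z N l \<le> exp (real N * a)) sequentially"
proof -
  have "eventually (\<lambda>N. ln (Z N l) / real N < a) sequentially"
    using order_tendstoD(2)[OF cgf_limit[of l] assms] by (simp add: Z_def)
  then show ?thesis using eventually_gt_at_top[of 0]
  proof eventually_elim
    case (elim N)
    then have "ln (Z N l) \<le> real N * a" by (simp add: field_simps)
    then show ?case using Z_pos[of N l] by (metis exp_le_cancel_iff exp_ln)
  qed
qed

lemma eventually_Z_ge:
  assumes "a < F l"
  shows "eventually (\<lambda>N. exp (real N * a) \<le> Z N l) sequentially"
proof -
  have "eventually (\<lambda>N. ln (Z N l) / real N > a) sequentially"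
    using order_tendstoD(1)[OF cgf_limit[of l] assms] by (simp add: Z_def)
  then show ?thesis using eventually_gt_at_top[of 0]
  proof eventually_elim
    case (elim N)
    then have "ln (Z N l) \<ge> real N * a" by (simp add: field_simps)
    then show ?case using Z_pos[of N l] by (metis exp_le_cancel_iff exp_ln)
  qed
qed

lemma F_zero: "F 0 = 0"
proof -
  have "(\<lambda>N. 0) \<longlonglongrightarrow> F 0" using cgf_limit[of 0] by (simp add: prob_space)
  then show ?thesis by (simp add: LIMSEQ_const_iff)
qed

text \<open>The open sets on which some \<open>l * x - F l\<close> exceeds \<open>m\<close> cover
  the compact part of \<open>C\<close>, so finitely many slopes \<open>l\<close> suffice. Each
  contributes one exponential Chebyshev bound, and their number disappears on the logarithmic scale.
  The gap between \<open>m'\<close> and \<open>m\<close> absorbs the error of the convergence to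
  \<open>F\<close> at these finitely many slopes.\<close>

lemma ldp_upper_bound_real:
  assumes "closed C" and m: "\<And>x. x \<in> C \<Longrightarrow> ereal m < legendre F x" and "m' < m"
  shows "limsup (\<lambda>N. ereal (1 / real N) * elog (prob {\<omega> \<in> space M. Y N \<omega> \<in> C})) \<le> ereal (- m')"
proof -
  define K where "K = C \<inter> {-B..B}"
  define U where "U l = {x. m < l * x - F l}" for l
  have "compact K" unfolding K_def by (intro closed_Int_compact assms) auto
  moreover have "open (U l)" for l
    unfolding U_def by (intro open_Collect_less continuous_intros)
  moreover have "K \<subseteq> (\<Union>l\<in>UNIV. U l)"
  proof
    fix x assume "x \<in> K"
    then have "ereal m < (SUP l::real. ereal (l * x - F l))"
      using m[of x] by (auto simp: K_def legendre_def)
    then obtain l where "ereal m < ereal (l * x - F l)" unfolding less_SUP_iff by auto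
    then show "x \<in> (\<Union>l\<in>UNIV. U l)" by (auto simp: U_def)
  qed
  ultimately obtain D where D: "finite D" "K \<subseteq> (\<Union>l\<in>D. U l)"
    by (elim compactE_image[of K UNIV U]) auto
  have bound: "prob {\<omega> \<in> space M. Y N \<omega> \<in> C} \<le> (\<Sum>l\<in>D. exp (- (real N * (F l + m))) * Z N l)" for N
  proof -
    have [measurable]: "C \<in> sets borel" using \<open>closed C\<close> by simp
    have "prob {\<omega> \<in> space M. Y N \<omega> \<in> C} = expectation (indicator {\<omega> \<in> space M. Y N \<omega> \<in> C})"
      by simp
    also have "\<dots> \<le> expectation (\<lambda>\<omega>. \<Sum>l\<in>D. exp (- (real N * (F l + m))) * exp (l * (real N * Y N \<omega>)))"
    proof (rule integral_mono)
      fix \<omega> assume \<omega>: "\<omega> \<in> space M"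
      show "indicator {\<omega> \<in> space M. Y N \<omega> \<in> C} \<omega>
        \<le> (\<Sum>l\<in>D. exp (- (real N * (F l + m))) * exp (l * (real N * Y N \<omega>)))"
      proof (cases "Y N \<omega> \<in> C")
        case True
        then have "Y N \<omega> \<in> K" using Y_bounded[OF \<omega>, of N] by (auto simp: K_def abs_le_iff)
        then obtain l where l: "l \<in> D" "m < l * Y N \<omega> - F l" using D by (auto simp: U_def)
        have "real N * (F l + m) \<le> real N * (l * Y N \<omega>)" using l(2) by (intro mult_left_mono) auto
        then have "1 \<le> exp (- (real N * (F l + m)) + l * (real N * Y N \<omega>))"
          by (simp add: algebra_simps)
        also have "\<dots> = exp (- (real N * (F l + m))) * exp (l * (real N * Y N \<omega>))"
          by (rule exp_add)
        also have "\<dots> \<le> (\<Sum>l\<in>D. exp (- (real N * (F l + m))) * exp (l * (real N * Y N \<omega>)))"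
          using l(1) D(1) by (intro member_le_sum) auto
        finally show ?thesis using \<omega> True by simp
      next
        case False
        then show ?thesis by (simp add: sum_nonneg)
      qed
    qed (auto intro!: integrable_real_indicator simp: emeasure_eq_measure)
    also have "\<dots> = (\<Sum>l\<in>D. exp (- (real N * (F l + m))) * Z N l)"
      by (simp add: Z_def)
    finally show ?thesis .
  qed
  have "eventually (\<lambda>N. \<forall>l\<in>D. Z N l \<le> exp (real N * (F l + (m - m')))) sequentially"
    using D(1) \<open>m' < m\<close> by (intro eventually_ball_finite ballI eventually_Z_le) auto
  then have "eventually (\<lambda>N. prob {\<omega> \<in> space M. Y N \<omega> \<in> C}
      \<le> (real (card D) + 1) * exp (- (real N * m'))) sequentially"
  proof eventually_elim
    case (elim N)
    have "prob {\<omega> \<in> space M. Y N \<omega> \<in> C} \<le> (\<Sum>l\<in>D. exp (- (real N * (F l + m))) * Z N l)"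
      by (rule bound)
    also have "\<dots> \<le> (\<Sum>l\<in>D. exp (- (real N * (F l + m))) * exp (real N * (F l + (m - m'))))"
      using elim by (intro sum_mono mult_left_mono) auto
    also have "\<dots> = (\<Sum>l\<in>D. exp (- (real N * m')))"
      by (simp add: exp_add[symmetric] algebra_simps)
    \<comment> \<open>The extra 1 keeps the constant positive when \<open>D\<close> is empty, as
      \<open>limsup_elog_le\<close> requires.\<close>
    also have "\<dots> \<le> (real (card D) + 1) * exp (- (real N * m'))" by (simp add: algebra_simps)
    finally show ?case .
  qed
  then show ?thesis by (rule limsup_elog_le) auto
qed

lemma ldp_upper_bound:
  assumes "closed C"
  shows "limsup (\<lambda>N. ereal (1 / real N) * elog (prob {\<omega> \<in> space M. Y N \<omega> \<in> C}))
    \<le> - (INF x\<in>C. legendre F x)" (is "?L \<le> - ?J")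
proof (rule ccontr)
  assume "\<not> ?L \<le> - ?J"
  then have "- ?J < ?L" by simp
  \<comment> \<open>The infimum may be infinite, so two real levels are inserted: \<open>- r\<close>
    stays strictly below the rate function on \<open>C\<close>, and \<open>- s\<close> is the
    slightly weaker rate that the real version delivers.\<close>
  then obtain r where r: "- ?J < ereal r" "ereal r < ?L" using ereal_dense2 by blast
  obtain s where s: "ereal r < ereal s" "ereal s < ?L" using ereal_dense2[OF r(2)] by blast
  have "- ereal r < ?J" using r(1) ereal_uminus_less_reorder by blast
  then have "ereal (- r) < legendre F x" if "x \<in> C" for x
    using less_INF_D[OF _ that, of "ereal (- r)" "legendre F"] by simp
  then have "?L \<le> ereal (- (- s))"
    using s(1) by (intro ldp_upper_bound_real[OF assms, of "- r"]) auto
  then show False using s(2) by simp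
qed

text \<open>Under the law tilted by \<open>l\<close> the variable concentrates at \<open>y\<close>,
  the derivative of \<open>F\<close> at \<open>l\<close>. Tilting further by \<open>t\<close> or
  \<open>- t\<close> costs \<open>F (l + t) - F l\<close> or \<open>F (l - t) - F l\<close>, which
  differs from \<open>t * y\<close> or \<open>- t * y\<close> by less than
  \<open>t * \<eta> / 2\<close>, while a deviation of size \<open>\<eta>\<close> gains
  \<open>t * \<eta>\<close>. The balance is \<open>c = t * \<eta> / 2\<close>, and the two tails
  give the factor 2.\<close>

lemma tilted_tail:
  assumes D: "(F has_field_derivative y) (at l)" and "\<eta> > 0"
  obtains c where "c > 0"
    "eventually (\<lambda>N. expectation (\<lambda>\<omega>. indicator {\<omega> \<in> space M. \<eta> \<le> \<bar>Y N \<omega> - y\<bar>} \<omega>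
        * exp (l * (real N * Y N \<omega>))) \<le> 2 * exp (real N * (F l - c))) sequentially"
proof -
  obtain d where d: "d > 0" "\<And>z. z \<noteq> 0 \<Longrightarrow> \<bar>z\<bar> < d \<Longrightarrow> \<bar>(F (l + z) - F l) / z - y\<bar> < \<eta> / 2"
    using LIM_D[OF DERIV_D[OF D], of "\<eta> / 2"] \<open>\<eta> > 0\<close> by auto
  define t where "t = d / 2"
  have t: "t > 0" using d by (simp add: t_def)
  have "\<bar>(F (l + t) - F l) / t - y\<bar> < \<eta> / 2" using d by (intro d(2)) (auto simp: t_def)
  then have "(F (l + t) - F l) / t < y + \<eta> / 2" by linarith
  then have up: "F (l + t) < F l + t * y + t * \<eta> / 2" using t by (simp add: field_simps)
  have "\<bar>(F (l + - t) - F l) / (- t) - y\<bar> < \<eta> / 2" using d by (intro d(2)) (auto simp: t_def)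
  moreover have "(F (l + - t) - F l) / (- t) = (F l - F (l - t)) / t"
    by (simp add: minus_divide_right[symmetric] minus_divide_left)
  ultimately have "(F l - F (l - t)) / t > y - \<eta> / 2" by linarith
  then have dn: "F (l - t) < F l - t * y + t * \<eta> / 2" using t by (simp add: field_simps)
  define c where "c = t * \<eta> / 2"
  have "c > 0" using t \<open>\<eta> > 0\<close> by (simp add: c_def)
  have "eventually (\<lambda>N. Z N (l + t) \<le> exp (real N * (F l + t * y + t * \<eta> / 2)) \<and>
      Z N (l - t) \<le> exp (real N * (F l - t * y + t * \<eta> / 2))) sequentially"
    by (intro eventually_conj eventually_Z_le up dn)
  then have "eventually (\<lambda>N. expectation (\<lambda>\<omega>. indicator {\<omega> \<in> space M. \<eta> \<le> \<bar>Y N \<omega> - y\<bar>} \<omega>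
        * exp (l * (real N * Y N \<omega>))) \<le> 2 * exp (real N * (F l - c))) sequentially"
  proof eventually_elim
    case (elim N)
    \<comment> \<open>The weights \<open>u\<close> and \<open>v\<close> are normalised so that
      \<open>u * exp ((l + t) * ...)\<close> dominates the tilted density on the right tail and
      \<open>v * exp ((l - t) * ...)\<close> on the left tail.\<close>
    define u where "u = exp (- (real N * t * (y + \<eta>)))"
    define v where "v = exp (real N * t * (y - \<eta>))"
    have "expectation (\<lambda>\<omega>. indicator {\<omega> \<in> space M. \<eta> \<le> \<bar>Y N \<omega> - y\<bar>} \<omega> * exp (l * (real N * Y N \<omega>)))
      \<le> expectation (\<lambda>\<omega>. u * exp ((l + t) * (real N * Y N \<omega>)) + v * exp ((l - t) * (real N * Y N \<omega>)))"
    proof (rule integral_mono)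
      show "integrable M (\<lambda>\<omega>. indicator {\<omega> \<in> space M. \<eta> \<le> \<bar>Y N \<omega> - y\<bar>} \<omega> * exp (l * (real N * Y N \<omega>)))"
        by (rule integrable_indicator_tilt) simp
      fix \<omega> assume \<omega>: "\<omega> \<in> space M"
      have u: "u * exp ((l + t) * (real N * Y N \<omega>))
        = exp (l * (real N * Y N \<omega>)) * exp (real N * t * (Y N \<omega> - y - \<eta>))"
        by (simp add: u_def exp_add[symmetric] algebra_simps)
      have v: "v * exp ((l - t) * (real N * Y N \<omega>))
        = exp (l * (real N * Y N \<omega>)) * exp (real N * t * (y - \<eta> - Y N \<omega>))"
        by (simp add: v_def exp_add[symmetric] algebra_simps)
      have "1 \<le> exp (real N * t * (Y N \<omega> - y - \<eta>)) + exp (real N * t * (y - \<eta> - Y N \<omega>))"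
        if "\<eta> \<le> \<bar>Y N \<omega> - y\<bar>"
      proof (cases "Y N \<omega> \<ge> y")
        case True
        then have "0 \<le> real N * t * (Y N \<omega> - y - \<eta>)" using that t by simp
        then show ?thesis by (simp add: add_increasing2)
      next
        case False
        then have "0 \<le> real N * t * (y - \<eta> - Y N \<omega>)" using that t by simp
        then show ?thesis by (simp add: add_increasing)
      qed
      then have "exp (l * (real N * Y N \<omega>)) * 1 \<le> exp (l * (real N * Y N \<omega>)) *
        (exp (real N * t * (Y N \<omega> - y - \<eta>)) + exp (real N * t * (y - \<eta> - Y N \<omega>)))"
        if "\<eta> \<le> \<bar>Y N \<omega> - y\<bar>" using that by (intro mult_left_mono) auto
      then show "indicator {\<omega> \<in> space M. \<eta> \<le> \<bar>Y N \<omega> - y\<bar>} \<omega> * exp (l * (real N * Y N \<omega>))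
        \<le> u * exp ((l + t) * (real N * Y N \<omega>)) + v * exp ((l - t) * (real N * Y N \<omega>))"
        unfolding u v distrib_left[symmetric] by (auto simp: indicator_def)
    qed auto
    also have "\<dots> = u * Z N (l + t) + v * Z N (l - t)"
      by (simp add: Z_def)
    also have "\<dots> \<le> u * exp (real N * (F l + t * y + t * \<eta> / 2)) + v * exp (real N * (F l - t * y + t * \<eta> / 2))"
      using elim by (intro add_mono mult_left_mono) (auto simp: u_def v_def)
    also have "\<dots> = 2 * exp (real N * (F l - c))"
      by (simp add: u_def v_def c_def exp_add[symmetric] algebra_simps)
    finally show ?case .
  qed
  with \<open>c > 0\<close> show ?thesis by (rule that)
qed

text \<open>\<open>Z N l\<close> is split at distance \<open>\<eta>\<close> from \<open>y\<close>.
  The far part is exponentially smaller than \<open>Z N l\<close> itself by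
  \<open>tilted_tail\<close>; on the near part the density is at most \<open>b\<close>. So the near
  event has probability at least about half of \<open>Z N l / b\<close>.\<close>

lemma local_lower_bound:
  assumes D: "(F has_field_derivative y) (at l)" and "\<eta> > 0" and "a < F l - l * y - \<bar>l\<bar> * \<eta>"
  shows "eventually (\<lambda>N. (1/2) * exp (real N * a) \<le> prob {\<omega> \<in> space M. \<bar>Y N \<omega> - y\<bar> < \<eta>}) sequentially"
proof -
  obtain c where c: "c > 0"
    "eventually (\<lambda>N. expectation (\<lambda>\<omega>. indicator {\<omega> \<in> space M. \<eta> \<le> \<bar>Y N \<omega> - y\<bar>} \<omega>
        * exp (l * (real N * Y N \<omega>))) \<le> 2 * exp (real N * (F l - c))) sequentially"
    using tilted_tail[OF D \<open>\<eta> > 0\<close>] by blast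
  \<comment> \<open>The first bound lets the lower estimate of \<open>Z N l\<close> beat the tail by
    a factor \<open>exp (real N * c / 2)\<close>; the second leaves the rate \<open>a\<close> after
    division by \<open>b\<close>.\<close>
  define e where "e = min (c / 2) (F l - l * y - \<bar>l\<bar> * \<eta> - a)"
  have e: "e > 0" "e \<le> c / 2" "e \<le> F l - l * y - \<bar>l\<bar> * \<eta> - a"
    using assms(3) c(1) unfolding e_def by linarith+
  have "((\<lambda>N. exp (- (c / 2) * real N)) \<longlongrightarrow> 0) sequentially"
    using c(1) by real_asymp
  \<comment> \<open>The tail carries a factor 2, so the threshold 1/4 makes it at most half of the
    lower estimate of \<open>Z N l\<close>.\<close>
  then have "eventually (\<lambda>N. exp (- (c / 2) * real N) < 1 / 4) sequentially"
    by (rule order_tendstoD(2)) simp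
  moreover have "eventually (\<lambda>N. exp (real N * (F l - e)) \<le> Z N l) sequentially"
    using e by (intro eventually_Z_ge) auto
  ultimately show ?thesis using c(2)
  proof eventually_elim
    case (elim N)
    let ?A = "{\<omega> \<in> space M. \<eta> \<le> \<bar>Y N \<omega> - y\<bar>}" and ?G = "{\<omega> \<in> space M. \<bar>Y N \<omega> - y\<bar> < \<eta>}"
    let ?X = "\<lambda>\<omega>. exp (l * (real N * Y N \<omega>))"
    define b where "b = exp (real N * (l * y + \<bar>l\<bar> * \<eta>))"
    have int: "integrable M (\<lambda>\<omega>. indicator ?A \<omega> * ?X \<omega>)"
      by (rule integrable_indicator_tilt) simp
    have "Z N l \<le> expectation (\<lambda>\<omega>. indicator ?A \<omega> * ?X \<omega> + b * indicator ?G \<omega>)"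
      unfolding Z_def
    proof (rule integral_mono)
      show "integrable M (\<lambda>\<omega>. indicator ?A \<omega> * ?X \<omega> + b * indicator ?G \<omega>)"
        by (intro Bochner_Integration.integrable_add int integrable_mult_right integrable_real_indicator)
           (auto simp: emeasure_eq_measure)
      fix \<omega> assume \<omega>: "\<omega> \<in> space M"
      have "?X \<omega> \<le> b" if "\<bar>Y N \<omega> - y\<bar> < \<eta>"
      proof -
        have "l * (Y N \<omega> - y) \<le> \<bar>l\<bar> * \<bar>Y N \<omega> - y\<bar>" by (metis abs_ge_self abs_mult)
        also have "\<dots> \<le> \<bar>l\<bar> * \<eta>" using that by (intro mult_left_mono) auto
        finally have "real N * (l * Y N \<omega>) \<le> real N * (l * y + \<bar>l\<bar> * \<eta>)"
          by (intro mult_left_mono) (auto simp: algebra_simps)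
        then show ?thesis by (simp add: b_def algebra_simps)
      qed
      then show "?X \<omega> \<le> indicator ?A \<omega> * ?X \<omega> + b * indicator ?G \<omega>"
        using \<omega> by (auto simp: indicator_def b_def)
    qed auto
    also have "\<dots> = expectation (\<lambda>\<omega>. indicator ?A \<omega> * ?X \<omega>) + b * prob ?G"
      by (subst Bochner_Integration.integral_add[OF int])
         (auto intro!: integrable_mult_right simp: emeasure_eq_measure)
    also have "\<dots> \<le> 2 * exp (real N * (F l - c)) + b * prob ?G" using elim by simp
    finally have "exp (real N * (F l - e)) \<le> 2 * exp (real N * (F l - c)) + b * prob ?G"
      using elim by linarith
    moreover have "2 * exp (real N * (F l - c)) \<le> (1/2) * exp (real N * (F l - e))"
    proof -
      have "real N * e \<le> real N * (c / 2)" using e by (intro mult_left_mono) auto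
      then have "exp (real N * (F l - c)) \<le> exp (- (c / 2) * real N + real N * (F l - e))"
        by (simp add: algebra_simps)
      also have "\<dots> = exp (- (c / 2) * real N) * exp (real N * (F l - e))" by (rule exp_add)
      also have "\<dots> \<le> (1/4) * exp (real N * (F l - e))" using elim by (intro mult_right_mono) auto
      finally show ?thesis by simp
    qed
    ultimately have "(1/2) * exp (real N * (F l - e)) \<le> b * prob ?G" by linarith
    then have "(1/2) * (exp (real N * (F l - e)) / b) \<le> prob ?G"
      by (simp add: b_def field_simps)
    moreover have "exp (real N * a) \<le> exp (real N * (F l - e)) / b"
    proof -
      have "real N * a \<le> real N * (F l - e - (l * y + \<bar>l\<bar> * \<eta>))"
        using e by (intro mult_left_mono) auto
      then show ?thesis by (simp add: b_def exp_diff[symmetric] algebra_simps)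
    qed
    ultimately show ?case by simp
  qed
qed

text \<open>A point \<open>x\<close> of \<open>G\<close> with infinite transform imposes no
  condition. Otherwise \<open>x\<close> is replaced by a nearby exposed point \<open>y\<close>,
  where the change of measure by \<open>l\<close> applies and the cost \<open>l * y - F l\<close> is
  no larger than the transform at \<open>x\<close>.\<close>

lemma ldp_lower_bound:
  assumes diff: "\<And>l. F differentiable (at l)" and "open G"
  shows "- (INF x\<in>G. legendre F x)
    \<le> liminf (\<lambda>N. ereal (1 / real N) * elog (prob {\<omega> \<in> space M. Y N \<omega> \<in> G}))" (is "_ \<le> ?L")
proof -
  have "- ?L \<le> legendre F x" if "x \<in> G" for x
  proof (cases "legendre F x")
    case (real r)
    have fin: "l * x - F l \<le> r" for l using legendre_ge[of l x F] real by simp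
    obtain \<epsilon> where \<epsilon>: "\<epsilon> > 0" "ball x \<epsilon> \<subseteq> G" using \<open>open G\<close> \<open>x \<in> G\<close> open_contains_ball by blast
    obtain l y where ly: "(F has_field_derivative y) (at l)" "\<bar>y - x\<bar> < \<epsilon> / 2" "l * y - F l \<le> r"
      using legendre_exposed_point[OF diff F_zero fin, of "\<epsilon> / 2"] \<epsilon>(1) half_gt_zero by metis
    have "ereal (- r) \<le> ?L + ereal e" if "e > 0" for e
    proof -
      \<comment> \<open>The first bound keeps the window around \<open>y\<close> inside the ball
        around \<open>x\<close>; the second makes \<open>\<bar>l\<bar> * \<eta>\<close> smaller than
        \<open>e\<close>, with \<open>+ 1\<close> to allow \<open>l = 0\<close>.\<close>
      define \<eta> where "\<eta> = min (\<epsilon> / 2) (e / (2 * (\<bar>l\<bar> + 1)))"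
      have \<eta>: "\<eta> > 0" "\<eta> \<le> \<epsilon> / 2"
        using \<epsilon>(1) \<open>e > 0\<close> unfolding \<eta>_def by (simp_all only: min.cobounded1 min_less_iff_conj) simp
      have "\<bar>l\<bar> * \<eta> \<le> \<bar>l\<bar> * (e / (2 * (\<bar>l\<bar> + 1)))" by (intro mult_left_mono) (auto simp: \<eta>_def)
      also have "\<dots> < e" using \<open>e > 0\<close> by (simp add: field_simps) (smt (verit) mult_nonneg_nonneg abs_ge_zero)
      finally have "- r - e < F l - l * y - \<bar>l\<bar> * \<eta>" using ly(3) by linarith
      from local_lower_bound[OF ly(1) \<eta>(1) this]
      have "eventually (\<lambda>N. (1/2) * exp (real N * (- r - e)) \<le> prob {\<omega> \<in> space M. Y N \<omega> \<in> G}) sequentially"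
      proof eventually_elim
        case (elim N)
        have [measurable]: "G \<in> sets borel" using \<open>open G\<close> by simp
        have "prob {\<omega> \<in> space M. \<bar>Y N \<omega> - y\<bar> < \<eta>} \<le> prob {\<omega> \<in> space M. Y N \<omega> \<in> G}"
        proof (rule finite_measure_mono)
          show "{\<omega> \<in> space M. \<bar>Y N \<omega> - y\<bar> < \<eta>} \<subseteq> {\<omega> \<in> space M. Y N \<omega> \<in> G}"
          proof safe
            fix \<omega> assume "\<bar>Y N \<omega> - y\<bar> < \<eta>"
            then have "\<bar>x - Y N \<omega>\<bar> < \<epsilon>" using ly(2) \<eta> by linarith
            then have "Y N \<omega> \<in> ball x \<epsilon>" by (simp add: dist_real_def)
            then show "Y N \<omega> \<in> G" using \<epsilon> by auto
          qed
        qed simp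
        then show ?case using elim by linarith
      qed
      then have "ereal (- r - e) \<le> ?L" by (rule liminf_elog_ge) simp
      then have "ereal (- r - e) + ereal e \<le> ?L + ereal e" by (rule add_right_mono)
      then show ?thesis by simp
    qed
    then have "ereal (- r) \<le> ?L" by (rule ereal_le_epsilon2[rule_format])
    then show ?thesis using real ereal_uminus_le_reorder by auto
  next
    case MInf
    then show ?thesis using legendre_ge[of 0 x F] by simp
  qed simp
  then have "- ?L \<le> (INF x\<in>G. legendre F x)" by (rule INF_greatest)
  then show ?thesis using ereal_uminus_le_reorder by blast
qed

theorem gaertner_ellis:
  assumes "\<And>l. F differentiable (at l)"
  shows "LDP M Y (legendre F)"
  unfolding LDP_def
proof (intro conjI allI impI)
  show "0 \<le> legendre F x" for x using legendre_ge[of 0 x F] F_zero by (simp add: zero_ereal_def)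
qed (use lower_semicont_legendre ldp_upper_bound ldp_lower_bound[OF assms] in auto)

end

section \<open>Chains of indices\<close>

definition odds_upto :: "nat \<Rightarrow> nat set" where
  "odds_upto N = {k. odd k \<and> k \<le> N}"

text \<open>This counts bonds: one for each site \<open>k * 2 ^ j\<close> not exceeding
  \<open>N\<close>. The last bond ends at a site beyond \<open>N\<close>, so the chain involves
  \<open>chain_len N k + 1\<close> spins.\<close>

definition chain_len :: "nat \<Rightarrow> nat \<Rightarrow> nat" where
  "chain_len N k = (LEAST n. N < k * 2 ^ n)"

lemma finite_odds_upto [simp, intro]: "finite (odds_upto N)"
  unfolding odds_upto_def by simp

lemma card_odds_upto: "card (odds_upto N) = (N + 1) div 2"
proof -
  have "odds_upto N = (\<lambda>i. 2 * i + 1) ` {..<(N + 1) div 2}"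
    by (auto simp: odds_upto_def image_iff elim!: oddE)
  moreover have "inj_on (\<lambda>i::nat. 2 * i + 1) {..<(N + 1) div 2}" by (auto simp: inj_on_def)
  ultimately show ?thesis by (simp add: card_image)
qed

lemma less_chain_len_iff:
  assumes "k > 0" shows "j < chain_len N k \<longleftrightarrow> k * 2 ^ j \<le> N"
proof -
  have "N < k * 2 ^ N"
    using assms by (metis less_exp less_le_trans mult.commute mult_le_mono2 mult.right_neutral Suc_leI One_nat_def)
  then have L: "N < k * 2 ^ chain_len N k" unfolding chain_len_def by (rule LeastI)
  show ?thesis
  proof
    assume "j < chain_len N k"
    then show "k * 2 ^ j \<le> N" unfolding chain_len_def using not_less_Least not_less by blast
  next
    assume "k * 2 ^ j \<le> N"
    then have "k * 2 ^ j < k * 2 ^ chain_len N k" using L by linarith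
    then show "j < chain_len N k" using assms by simp
  qed
qed

lemma odd_mult_power_two_inj:
  assumes "odd (k::nat)" "odd k'" "k * 2 ^ i = k' * 2 ^ j"
  shows "k = k' \<and> i = j"
proof -
  have "multiplicity 2 (k * 2 ^ i) = i" if "odd k" for k i :: nat
    using that by (intro multiplicity_decomposeI[where x' = k]) auto
  then have "i = j" using assms by metis
  then show ?thesis using assms by simp
qed

text \<open>Every positive integer is uniquely an odd number times a power of 2, so the chains
  partition the sites from 1 to \<open>N\<close>.\<close>

lemma sum_chains:
  fixes f :: "nat \<Rightarrow> 'b::comm_monoid_add"
  shows "(\<Sum>i=1..N. f i) = (\<Sum>k\<in>odds_upto N. \<Sum>j<chain_len N k. f (k * 2 ^ j))"
proof -
  let ?A = "SIGMA k:odds_upto N. {..<chain_len N k}"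
  have len: "j < chain_len N k \<longleftrightarrow> k * 2 ^ j \<le> N" if "odd k" for j k
    using less_chain_len_iff[of k] that by (auto simp: odd_pos)
  have inj: "inj_on (\<lambda>(k, j). k * 2 ^ j) ?A"
    by (auto simp: inj_on_def odds_upto_def dest: odd_mult_power_two_inj)
  have "(\<lambda>(k, j). k * 2 ^ j) ` ?A = {1..N}"
  proof (intro equalityI subsetI)
    fix i assume i: "i \<in> {1..N}"
    obtain k j where kj: "odd k" "i = k * 2 ^ j"
    proof (rule multiplicity_decompose'[of i 2])
      show "i \<noteq> 0" "\<not> is_unit (2 :: nat)" using i by auto
      fix y assume "i = 2 ^ multiplicity 2 i * y" "odd y"
      then show thesis by (metis that mult.commute)
    qed
    have "k \<le> k * 2 ^ j" by simp
    then have "k \<le> N" using i kj(2) by (metis atLeastAtMost_iff le_trans)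
    then have "(k, j) \<in> ?A" using kj i len by (auto simp: odds_upto_def)
    then show "i \<in> (\<lambda>(k, j). k * 2 ^ j) ` ?A" using kj by force
  qed (auto simp: odds_upto_def len odd_pos Suc_le_eq)
  then have "(\<Sum>i=1..N. f i) = (\<Sum>i\<in>(\<lambda>(k, j). k * 2 ^ j) ` ?A. f i)" by simp
  also have "\<dots> = (\<Sum>(k, j)\<in>?A. f (k * 2 ^ j))"
    by (subst sum.reindex[OF inj]) (auto intro!: sum.cong)
  also have "\<dots> = (\<Sum>k\<in>odds_upto N. \<Sum>j<chain_len N k. f (k * 2 ^ j))"
    by (rule sum.Sigma[symmetric]) auto
  finally show ?thesis .
qed

section \<open>Limiting frequencies of the chain lengths\<close>

definition chain_count :: "nat \<Rightarrow> nat \<Rightarrow> nat" where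
  "chain_count N n = card {k \<in> odds_upto N. chain_len N k = n}"

text \<open>A chain from \<open>k\<close> has more than \<open>m\<close> bonds exactly when
  \<open>k * 2 ^ m\<close> is at most \<open>N\<close>, that is, when \<open>k\<close> is an odd
  number up to \<open>N div 2 ^ m\<close>. Counting tails first avoids counting odd numbers in
  intervals; the exact counts follow by subtraction.\<close>

lemma card_chain_len_greater:
  "card {k \<in> odds_upto N. m < chain_len N k} = (N div 2 ^ m + 1) div 2"
proof -
  have "{k \<in> odds_upto N. m < chain_len N k} = odds_upto (N div 2 ^ m)"
  proof (intro equalityI subsetI)
    fix k assume k: "k \<in> odds_upto (N div 2 ^ m)"
    then have "k * 2 ^ m \<le> N" 
      by (simp add: odds_upto_def less_eq_div_iff_mult_less_eq)
    moreover have "k \<le> k * 2 ^ m" by simp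
    ultimately have "k \<le> N" by linarith
    with k \<open>k * 2 ^ m \<le> N\<close> show "k \<in> {k \<in> odds_upto N. m < chain_len N k}"
      by (auto simp: odds_upto_def less_chain_len_iff odd_pos)
  qed (auto simp: odds_upto_def less_chain_len_iff odd_pos less_eq_div_iff_mult_less_eq)
  then show ?thesis by (simp add: card_odds_upto)
qed

lemma chain_count_Suc:
  "real (chain_count N (Suc m))
    = real ((N div 2 ^ m + 1) div 2) - real ((N div 2 ^ Suc m + 1) div 2)"
proof -
  have "{k \<in> odds_upto N. m < chain_len N k}
      = {k \<in> odds_upto N. chain_len N k = Suc m} \<union> {k \<in> odds_upto N. Suc m < chain_len N k}" by auto
  then have "card {k \<in> odds_upto N. m < chain_len N k}
      = chain_count N (Suc m) + card {k \<in> odds_upto N. Suc m < chain_len N k}"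
    unfolding chain_count_def by (simp only:) (rule card_Un_disjoint, auto)
  then show ?thesis unfolding card_chain_len_greater by simp
qed

lemma chain_count_tendsto:
  "(\<lambda>N. real (chain_count N (Suc m)) / real N) \<longlonglongrightarrow> 1 / 2 ^ (m + 2)"
proof -
  have lim: "(\<lambda>N. real ((N div 2 ^ m + 1) div 2) / real N) \<longlonglongrightarrow> 1 / 2 ^ (m + 1)" for m
  proof (rule real_tendsto_sandwich)
    have lo: "real N / 2 ^ (m + 1) - 1 \<le> real ((N div 2 ^ m + 1) div 2)" 
      and hi: "real ((N div 2 ^ m + 1) div 2) \<le> real N / 2 ^ (m + 1) + 1" for N
    proof -
      have "real N / 2 ^ m - 1 \<le> real (N div 2 ^ m)" "real (N div 2 ^ m) \<le> real N / 2 ^ m"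
        using of_nat_div_le_of_nat[of N "2 ^ m", where 'a = real]
          floor_divide_of_nat_eq[of N "2 ^ m", where 'a = real, symmetric]
          real_of_int_floor_add_one_gt[of "real N / 2 ^ m"] by (simp_all, linarith)
      moreover have "real (N div 2 ^ m) \<le> 2 * real ((N div 2 ^ m + 1) div 2)"
        "2 * real ((N div 2 ^ m + 1) div 2) \<le> real (N div 2 ^ m) + 1" by linarith+
      ultimately show "real N / 2 ^ (m + 1) - 1 \<le> real ((N div 2 ^ m + 1) div 2)"
        "real ((N div 2 ^ m + 1) div 2) \<le> real N / 2 ^ (m + 1) + 1" by simp_all
    qed
    show "\<forall>\<^sub>F N in sequentially. 1 / 2 ^ (m + 1) - 1 / real N \<le> real ((N div 2 ^ m + 1) div 2) / real N"
      using eventually_gt_at_top[of 0]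
    proof eventually_elim
      case (elim N)
      then show ?case using divide_right_mono[OF lo[of N], of "real N"] by (simp add: diff_divide_distrib)
    qed
    show "\<forall>\<^sub>F N in sequentially. real ((N div 2 ^ m + 1) div 2) / real N \<le> 1 / 2 ^ (m + 1) + 1 / real N"
      using eventually_gt_at_top[of 0]
    proof eventually_elim
      case (elim N)
      then show ?case using divide_right_mono[OF hi[of N], of "real N"] by (simp add: add_divide_distrib)
    qed
    have "(\<lambda>N. 1 / 2 ^ (m + 1) - 1 / real N) \<longlonglongrightarrow> 1 / 2 ^ (m + 1) - 0"
      by (intro tendsto_intros lim_1_over_n)
    then show "(\<lambda>N. 1 / 2 ^ (m + 1) - 1 / real N) \<longlonglongrightarrow> 1 / 2 ^ (m + 1)" by simp
    have "(\<lambda>N. 1 / 2 ^ (m + 1) + 1 / real N) \<longlonglongrightarrow> 1 / 2 ^ (m + 1) + 0"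
      by (intro tendsto_intros lim_1_over_n)
    then show "(\<lambda>N. 1 / 2 ^ (m + 1) + 1 / real N) \<longlonglongrightarrow> 1 / 2 ^ (m + 1)" by simp
  qed
  have "(\<lambda>N. real (chain_count N (Suc m)) / real N) \<longlonglongrightarrow> 1 / 2 ^ (m + 1) - 1 / 2 ^ (Suc m + 1)"
    unfolding chain_count_Suc diff_divide_distrib by (intro tendsto_diff lim)
  then show ?thesis by (simp add: field_simps)
qed

lemma chain_count_le: "real (chain_count N (Suc m)) \<le> real N / 2 ^ m"
proof -
  have "(N div 2 ^ m + 1) div 2 \<le> N div 2 ^ m" by linarith
  then have "real ((N div 2 ^ m + 1) div 2) \<le> real (N div 2 ^ m)" by (rule of_nat_mono)
  also have "\<dots> \<le> real N / 2 ^ m" using of_nat_div_le_of_nat[of N "2 ^ m", where 'a = real] by simp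
  finally show ?thesis unfolding chain_count_Suc by simp
qed

text \<open>Grouping by length gives a finite sum, written as a series so that its range does not
  depend on \<open>N\<close> and the limit can be taken term by term. The index starts at
  \<open>Suc m\<close> because every odd \<open>k\<close> up to \<open>N\<close> carries at least
  the bond from \<open>k\<close> to \<open>2 * k\<close>.\<close>

lemma sum_chain_len_eq:
  fixes a :: "nat \<Rightarrow> real"
  shows "(\<Sum>k\<in>odds_upto N. a (chain_len N k)) = (\<Sum>m. real (chain_count N (Suc m)) * a (Suc m))"
proof -
  have pos: "0 < chain_len N k" if "k \<in> odds_upto N" for k
    using that less_chain_len_iff[of k 0 N] by (auto simp: odds_upto_def odd_pos)
  have le: "chain_len N k \<le> N" if "k \<in> odds_upto N" for k
  proof -
    have "\<not> k * 2 ^ N \<le> N" 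
      using that by (metis (no_types, lifting) less_exp less_le_trans linorder_not_less mult.commute mult_le_mono2
          mult.right_neutral Suc_leI One_nat_def odds_upto_def mem_Collect_eq odd_pos)
    then have "\<not> N < chain_len N k" using that by (subst less_chain_len_iff) (auto simp: odds_upto_def odd_pos)
    then show ?thesis by simp
  qed
  have "(\<Sum>k\<in>odds_upto N. a (chain_len N k))
    = (\<Sum>n\<in>Suc ` {..<N}. \<Sum>k\<in>{k \<in> odds_upto N. chain_len N k = n}. a (chain_len N k))"
  proof (rule sum.group[symmetric])
    show "chain_len N ` odds_upto N \<subseteq> Suc ` {..<N}"
    proof safe
      fix k assume "k \<in> odds_upto N"
      then show "chain_len N k \<in> Suc ` {..<N}"
        using pos[of k] le[of k] by (cases "chain_len N k") auto
    qed
  qed auto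
  also have "\<dots> = (\<Sum>m<N. real (chain_count N (Suc m)) * a (Suc m))"
    by (subst sum.reindex) (auto simp: chain_count_def intro!: sum.cong)
  also have "\<dots> = (\<Sum>m. real (chain_count N (Suc m)) * a (Suc m))"
  proof (rule suminf_finite[symmetric])
    fix m assume "m \<notin> {..<N}"
    then have "{k \<in> odds_upto N. chain_len N k = Suc m} = {}" using le by fastforce
    then show "real (chain_count N (Suc m)) * a (Suc m) = 0" by (simp add: chain_count_def)
  qed simp
  finally show ?thesis .
qed

text \<open>Dominated convergence for series: the frequency of the length \<open>Suc m\<close> tends
  to \<open>1 / 2 ^ (m + 2)\<close> and is bounded by \<open>1 / 2 ^ m\<close> uniformly in
  \<open>N\<close>.\<close>

lemma chain_average_tendsto:
  fixes a :: "nat \<Rightarrow> real"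
  assumes "summable (\<lambda>m. \<bar>a (Suc m)\<bar> / 2 ^ m)"
  shows "(\<lambda>N. (\<Sum>k\<in>odds_upto N. a (chain_len N k)) / real N) \<longlonglongrightarrow> (\<Sum>m. a (Suc m) / 2 ^ (m + 2))"
proof -
  have "(\<lambda>N. \<Sum>m. real (chain_count N (Suc m)) / real N * a (Suc m)) \<longlonglongrightarrow> (\<Sum>m. 1 / 2 ^ (m + 2) * a (Suc m))"
  proof (rule tannerys_theorem[THEN conjunct2, THEN conjunct2])
    show "(\<lambda>N. real (chain_count N (Suc m)) / real N * a (Suc m)) \<longlonglongrightarrow> 1 / 2 ^ (m + 2) * a (Suc m)" for m
      by (intro tendsto_mult chain_count_tendsto tendsto_const)
    have "norm (real (chain_count N (Suc m)) / real N * a (Suc m)) \<le> \<bar>a (Suc m)\<bar> / 2 ^ m" for m N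
    proof (cases "N = 0")
      case False
      then have "real (chain_count N (Suc m)) / real N \<le> 1 / 2 ^ m"
        using chain_count_le[of N m] by (simp add: field_simps)
      then have "real (chain_count N (Suc m)) / real N * \<bar>a (Suc m)\<bar> \<le> 1 / 2 ^ m * \<bar>a (Suc m)\<bar>"
        by (intro mult_right_mono) auto
      then show ?thesis by (simp add: abs_mult)
    qed simp
    then show "\<forall>\<^sub>F (m, N) in sequentially \<times>\<^sub>F sequentially.
        norm (real (chain_count N (Suc m)) / real N * a (Suc m)) \<le> \<bar>a (Suc m)\<bar> / 2 ^ m"
      by (intro always_eventually) auto
  qed (use assms in auto)
  moreover have "(\<Sum>k\<in>odds_upto N. a (chain_len N k)) / real N
      = (\<Sum>m. real (chain_count N (Suc m)) / real N * a (Suc m))" for N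
    using sum_chain_len_eq[where a = "\<lambda>n. a n / real N"] by (simp add: sum_divide_distrib)
  ultimately show ?thesis by simp
qed

lemma summable_power_geometric: "summable (\<lambda>m. real (Suc m) ^ q / 2 ^ m)"
proof -
  have "(\<lambda>m. (real (m + 2) / real (m + 1)) ^ q) \<longlonglongrightarrow> 1 ^ q"
    by (intro tendsto_power) real_asymp
  \<comment> \<open>Together with the factor 1/2 from the geometric part, the bound 3/2 gives the
    ratio 3/4 below.\<close>
  then have "eventually (\<lambda>m. (real (m + 2) / real (m + 1)) ^ q < 3 / 2) sequentially"
    by (rule order_tendstoD(2)) simp
  then obtain n where n: "\<And>m. m \<ge> n \<Longrightarrow> (real (m + 2) / real (m + 1)) ^ q < 3 / 2"
    unfolding eventually_sequentially by blast
  show ?thesis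
  proof (rule summable_ratio_test[of "3 / 4" n])
    fix m assume "n \<le> m"
    then have "real (m + 2) ^ q \<le> 3 / 2 * real (m + 1) ^ q"
      using n[of m] by (simp add: power_divide field_simps)
    then show "norm (real (Suc (Suc m)) ^ q / 2 ^ Suc m) \<le> 3 / 4 * norm (real (Suc m) ^ q / 2 ^ m)"
      by (simp add: field_simps)
  qed simp
qed

section \<open>Cumulant generating functions\<close>

context prob_space
begin

lemma expectation_finite_range:
  fixes X :: "'a \<Rightarrow> real" and f :: "real \<Rightarrow> real"
  assumes [measurable]: "X \<in> borel_measurable M" and "finite V" and V: "\<And>\<omega>. \<omega> \<in> space M \<Longrightarrow> X \<omega> \<in> V"
  shows "expectation (\<lambda>\<omega>. f (X \<omega>)) = (\<Sum>v\<in>V. f v * prob {\<omega> \<in> space M. X \<omega> = v})"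
proof -
  have "expectation (\<lambda>\<omega>. f (X \<omega>)) = expectation (\<lambda>\<omega>. \<Sum>v\<in>V. f v * indicator {\<omega> \<in> space M. X \<omega> = v} \<omega>)"
  proof (rule Bochner_Integration.integral_cong)
    fix \<omega> assume \<omega>: "\<omega> \<in> space M"
    have "(\<Sum>v\<in>V. f v * indicator {\<omega> \<in> space M. X \<omega> = v} \<omega>) = (\<Sum>v\<in>V. if X \<omega> = v then f v else 0)"
      using \<omega> by (intro sum.cong) (auto simp: indicator_def)
    then show "f (X \<omega>) = (\<Sum>v\<in>V. f v * indicator {\<omega> \<in> space M. X \<omega> = v} \<omega>)"
      using V[OF \<omega>] \<open>finite V\<close> by simp
  qed simp
  also have "\<dots> = (\<Sum>v\<in>V. expectation (\<lambda>\<omega>. f v * indicator {\<omega> \<in> space M. X \<omega> = v} \<omega>))"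
    by (intro Bochner_Integration.integral_sum integrable_mult_right integrable_real_indicator)
       (auto simp: emeasure_eq_measure)
  also have "\<dots> = (\<Sum>v\<in>V. f v * prob {\<omega> \<in> space M. X \<omega> = v})" by simp
  finally show ?thesis .
qed

end

text \<open>With finite range every expectation is a finite sum, so transforms can be differentiated
  without exchanging a limit with an integral.\<close>

locale finite_range_variable = prob_space +
  fixes X :: "'a \<Rightarrow> real" and V :: "real set" and B :: real
  assumes X_measurable [measurable]: "X \<in> borel_measurable M"
    and finite_V: "finite V" and X_in_V: "\<And>\<omega>. \<omega> \<in> space M \<Longrightarrow> X \<omega> \<in> V"
    and V_bounded: "\<And>v. v \<in> V \<Longrightarrow> \<bar>v\<bar> \<le> B"
begin

text \<open>This is the \<open>j\<close>-th derivative of the moment generating function. Divided by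
  \<open>tilted_moment 0 l\<close> it becomes a moment under the law tilted by \<open>l\<close>, so
  \<open>cgf_deriv\<close> and \<open>cgf_deriv2\<close> are the mean and the variance of that
  law.\<close>

definition tilted_moment :: "nat \<Rightarrow> real \<Rightarrow> real" where
  "tilted_moment j l = expectation (\<lambda>\<omega>. X \<omega> ^ j * exp (l * X \<omega>))"

definition cgf :: "real \<Rightarrow> real" where
  "cgf l = ln (expectation (\<lambda>\<omega>. exp (l * X \<omega>)))"

definition cgf_deriv :: "real \<Rightarrow> real" where
  "cgf_deriv l = tilted_moment 1 l / tilted_moment 0 l"

definition cgf_deriv2 :: "real \<Rightarrow> real" where
  "cgf_deriv2 l = tilted_moment 2 l / tilted_moment 0 l - (cgf_deriv l)\<^sup>2"

lemma tilted_moment_eq_sum: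
  "tilted_moment j l = (\<Sum>v\<in>V. v ^ j * exp (l * v) * prob {\<omega> \<in> space M. X \<omega> = v})"
  unfolding tilted_moment_def
  by (rule expectation_finite_range[where f = "\<lambda>v. v ^ j * exp (l * v)"]) (use finite_V X_in_V in auto)

lemma total_prob: "(\<Sum>v\<in>V. prob {\<omega> \<in> space M. X \<omega> = v}) = 1"
  using expectation_finite_range[where f = "\<lambda>_. 1" and X = X and V = V] finite_V X_in_V by (simp add: prob_space)

lemma mgf_pos: "0 < tilted_moment 0 l"
proof -
  have "tilted_moment 0 l \<noteq> 0"
  proof
    assume "tilted_moment 0 l = 0"
    then have "\<forall>v\<in>V. exp (l * v) * prob {\<omega> \<in> space M. X \<omega> = v} = 0"
      unfolding tilted_moment_eq_sum using finite_V by (subst (asm) sum_nonneg_eq_0_iff) auto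
    then show False using total_prob by simp
  qed
  moreover have "0 \<le> tilted_moment 0 l" unfolding tilted_moment_eq_sum by (intro sum_nonneg) auto
  ultimately show ?thesis by simp
qed

lemma cgf_eq_ln_mgf: "cgf l = ln (tilted_moment 0 l)"
  by (simp add: cgf_def tilted_moment_def)

lemma exp_cgf: "exp (cgf l) = expectation (\<lambda>\<omega>. exp (l * X \<omega>))"
  using mgf_pos[of l] by (simp add: cgf_def tilted_moment_def)

lemma tilted_moment_has_derivative:
  "(tilted_moment j has_field_derivative tilted_moment (Suc j) l) (at l)"
  unfolding tilted_moment_eq_sum
  by (auto intro!: derivative_eq_intros sum.cong simp: tilted_moment_eq_sum[abs_def] algebra_simps)

lemma cgf_has_derivative: "(cgf has_field_derivative cgf_deriv l) (at l)"
proof -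
  have "((\<lambda>l. ln (tilted_moment 0 l)) has_field_derivative cgf_deriv l) (at l)"
    using mgf_pos[of l]
    by (auto intro!: derivative_eq_intros tilted_moment_has_derivative simp: cgf_deriv_def)
  then show ?thesis by (simp add: cgf_eq_ln_mgf[abs_def])
qed

lemma cgf_deriv_has_derivative: "(cgf_deriv has_field_derivative cgf_deriv2 l) (at l)"
proof -
  have "((\<lambda>l. tilted_moment 1 l / tilted_moment 0 l) has_field_derivative cgf_deriv2 l) (at l)"
    using mgf_pos[of l]
    by (auto intro!: derivative_eq_intros tilted_moment_has_derivative
        simp: cgf_deriv2_def cgf_deriv_def field_simps power2_eq_square numeral_2_eq_2)
  then show ?thesis by (simp add: cgf_deriv_def[abs_def])
qed

lemma abs_tilted_moment_le: "\<bar>tilted_moment j l\<bar> \<le> B ^ j * tilted_moment 0 l"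
proof -
  have "\<bar>tilted_moment j l\<bar> \<le> (\<Sum>v\<in>V. \<bar>v ^ j * exp (l * v) * prob {\<omega> \<in> space M. X \<omega> = v}\<bar>)"
    unfolding tilted_moment_eq_sum by (rule sum_abs)
  also have "\<dots> \<le> (\<Sum>v\<in>V. B ^ j * (exp (l * v) * prob {\<omega> \<in> space M. X \<omega> = v}))"
    using V_bounded by (auto simp: abs_mult power_abs mult.assoc intro!: sum_mono mult_right_mono power_mono)
  also have "\<dots> = B ^ j * tilted_moment 0 l"
    by (simp add: tilted_moment_eq_sum sum_distrib_left)
  finally show ?thesis .
qed

lemma abs_cgf_deriv_le: "\<bar>cgf_deriv l\<bar> \<le> B"
  using abs_tilted_moment_le[of 1 l] mgf_pos[of l] by (simp add: cgf_deriv_def abs_divide field_simps)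

text \<open>A difference of two numbers that both lie between 0 and the square of
  \<open>B\<close>.\<close>

lemma abs_cgf_deriv2_le: "\<bar>cgf_deriv2 l\<bar> \<le> B\<^sup>2"
proof -
  have "\<bar>tilted_moment 2 l / tilted_moment 0 l\<bar> \<le> B\<^sup>2"
    using abs_tilted_moment_le[of 2 l] mgf_pos[of l] by (simp add: abs_divide field_simps)
  moreover have "0 \<le> tilted_moment 2 l / tilted_moment 0 l"
    using mgf_pos[of l] by (intro divide_nonneg_pos) (auto simp: tilted_moment_eq_sum intro!: sum_nonneg)
  moreover have "(cgf_deriv l)\<^sup>2 \<le> B\<^sup>2"
    using abs_cgf_deriv_le[of l] by (metis abs_ge_zero power2_abs power_mono)
  ultimately show ?thesis unfolding cgf_deriv2_def using zero_le_power2[of "cgf_deriv l"] by linarith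
qed

lemma abs_cgf_le: "\<bar>cgf l\<bar> \<le> \<bar>l\<bar> * B"
proof -
  have bound: "exp (- (\<bar>l\<bar> * B)) \<le> exp (l * v)" "exp (l * v) \<le> exp (\<bar>l\<bar> * B)" if "v \<in> V" for v
  proof -
    have "\<bar>l * v\<bar> \<le> \<bar>l\<bar> * B" using V_bounded[OF that] by (simp add: abs_mult mult_left_mono)
    then show "exp (- (\<bar>l\<bar> * B)) \<le> exp (l * v)" "exp (l * v) \<le> exp (\<bar>l\<bar> * B)" by auto
  qed
  have "tilted_moment 0 l \<le> (\<Sum>v\<in>V. exp (\<bar>l\<bar> * B) * prob {\<omega> \<in> space M. X \<omega> = v})"
    unfolding tilted_moment_eq_sum using bound by (auto intro!: sum_mono mult_right_mono)
  then have "tilted_moment 0 l \<le> exp (\<bar>l\<bar> * B)" by (simp add: sum_distrib_left[symmetric] total_prob)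
  moreover have "(\<Sum>v\<in>V. exp (- (\<bar>l\<bar> * B)) * prob {\<omega> \<in> space M. X \<omega> = v}) \<le> tilted_moment 0 l"
    unfolding tilted_moment_eq_sum using bound by (auto intro!: sum_mono mult_right_mono)
  then have "exp (- (\<bar>l\<bar> * B)) \<le> tilted_moment 0 l" by (simp add: sum_distrib_left[symmetric] total_prob)
  ultimately show ?thesis
    unfolding cgf_eq_ln_mgf using mgf_pos[of l]
    by (metis abs_le_iff exp_le_cancel_iff exp_ln minus_le_iff)
qed

lemma cgf_deriv_zero: "cgf_deriv 0 = expectation X"
  by (simp add: cgf_deriv_def tilted_moment_def prob_space)

lemma integrable_bounded_range: "integrable M (\<lambda>\<omega>. X \<omega> ^ j)"
  by (rule integrable_const_bound[where B = "B ^ j"])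
     (auto intro!: AE_I2 power_mono V_bounded X_in_V simp: power_abs)

lemma cgf_deriv2_zero: "cgf_deriv2 0 = variance X"
proof -
  have "variance X = expectation (\<lambda>\<omega>. (X \<omega>)\<^sup>2) - (expectation X)\<^sup>2"
    using integrable_bounded_range[of 1] integrable_bounded_range[of 2] by (intro variance_eq) auto
  then show ?thesis by (simp add: cgf_deriv2_def cgf_deriv_zero) (simp add: tilted_moment_def prob_space)
qed

end

section \<open>The transfer matrix\<close>

context
  fixes p :: real
  assumes p: "0 < p" "p < 1"
begin

lemma exp_field_h: "exp (field_h p) = sqrt (p / (1 - p))"
  using p unfolding field_h_def by (simp add: ln_sqrt[symmetric])

text \<open>The dictionary between Bernoulli weights and the magnetic field: up to the common factor
  \<open>sqrt (p * (1 - p))\<close> per spin, the weights are \<open>exp (field_h p)\<close> and its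
  inverse. This factor accounts for the powers of \<open>p * (1 - p)\<close> in the final
  formula.\<close>

lemma sqrt_mult_exp_field_h:
  "sqrt (p * (1 - p)) * exp (field_h p) = p" "sqrt (p * (1 - p)) * exp (- field_h p) = 1 - p"
proof -
  show 1: "sqrt (p * (1 - p)) * exp (field_h p) = p"
    using p unfolding exp_field_h by (simp add: real_sqrt_mult real_sqrt_divide)
  have "sqrt (p * (1 - p)) * exp (- field_h p) * p = sqrt (p * (1 - p)) * exp (- field_h p) * (sqrt (p * (1 - p)) * exp (field_h p))"
    by (simp only: 1)
  also have "\<dots> = sqrt (p * (1 - p)) ^ 2 * (exp (- field_h p) * exp (field_h p))" by (simp only: power2_eq_square mult_ac)
  also have "\<dots> = p * (1 - p)" using p by (simp add: exp_minus)
  finally show "sqrt (p * (1 - p)) * exp (- field_h p) = 1 - p" using p by simp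
qed

lemma sqrt_mult_two_cosh_field_h: "sqrt (p * (1 - p)) * (2 * cosh (field_h p)) = 1"
  using sqrt_mult_exp_field_h by (simp add: cosh_def algebra_simps)

text \<open>The trace of the transfer matrix; \<open>Lambda_mult\<close> is its determinant. The
  spectral algebra below uses the eigenvalues through these two symmetric functions.\<close>

lemma Lambda_add: "Lambda_plus p l + Lambda_minus p l = exp (l + field_h p) + exp (l - field_h p)"
proof -
  have "Lambda_plus p l + Lambda_minus p l = exp l * (2 * cosh (field_h p))"
    by (simp add: Lambda_plus_def Lambda_minus_def algebra_simps)
  also have "2 * cosh (field_h p) = exp (field_h p) + exp (- field_h p)" by (simp add: cosh_def)
  also have "exp l * \<dots> = exp (l + field_h p) + exp (l + - field_h p)"
    unfolding exp_add by (rule distrib_left)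
  finally show ?thesis by simp
qed

lemma Lambda_mult: "Lambda_plus p l * Lambda_minus p l = exp (2 * l) - exp (- 2 * l)"
proof -
  have "Lambda_plus p l * Lambda_minus p l
      = exp l ^ 2 * ((cosh (field_h p))\<^sup>2 - (sqrt ((sinh (field_h p))\<^sup>2 + exp (- 4 * l)))\<^sup>2)"
    unfolding Lambda_plus_def Lambda_minus_def by (simp add: algebra_simps power2_eq_square)
  also have "(sqrt ((sinh (field_h p))\<^sup>2 + exp (- 4 * l)))\<^sup>2 = (sinh (field_h p))\<^sup>2 + exp (- 4 * l)"
    by (simp add: add_nonneg_nonneg)
  also have "(cosh (field_h p))\<^sup>2 - ((sinh (field_h p))\<^sup>2 + exp (- 4 * l)) = 1 - exp (- 4 * l)"
    by (simp add: cosh_square_eq)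
  also have "exp l ^ 2 * (1 - exp (- 4 * l)) = exp (2 * l) - exp (- 2 * l)"
    by (simp add: right_diff_distrib exp_double[symmetric] exp_add[symmetric])
  finally show ?thesis .
qed

lemma Lambda_plus_pos: "0 < Lambda_plus p l"
  unfolding Lambda_plus_def by (intro mult_pos_pos add_pos_nonneg) (auto simp: cosh_real_pos)

text \<open>This fixes the sign of the second entry of \<open>vec_w_plus\<close>: both entries are
  negative while those of \<open>vec_v\<close> are positive, so their inner product cannot
  vanish.\<close>

lemma exp_less_Lambda_plus: "exp (field_h p + l) < Lambda_plus p l"
proof -
  have "sinh (field_h p) \<le> sqrt ((sinh (field_h p))\<^sup>2)" by simp
  also have "\<dots> < sqrt ((sinh (field_h p))\<^sup>2 + exp (- 4 * l))" by (rule real_sqrt_less_mono) simp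
  finally have "cosh (field_h p) + sinh (field_h p) < cosh (field_h p) + sqrt ((sinh (field_h p))\<^sup>2 + exp (- 4 * l))"
    by simp
  then have "exp l * exp (field_h p) < Lambda_plus p l"
    unfolding Lambda_plus_def cosh_plus_sinh by (intro mult_strict_left_mono) auto
  then show ?thesis by (simp add: exp_add mult.commute)
qed

text \<open>The coefficient of the power of \<open>Lambda_plus\<close> in the spectral expansion of
  \<open>v^T M^n v\<close>. The coefficient for \<open>Lambda_minus\<close> is its complement to the
  squared norm \<open>2 * cosh (field_h p)\<close> of \<open>vec_v\<close>.\<close>

definition overlap :: "real \<Rightarrow> real" where
  "overlap l = \<bar>vec_v p \<bullet> vec_e_plus p l\<bar>\<^sup>2"

lemma overlap_eq:
  "overlap l = (exp (field_h p / 2) * - exp (- l) + exp (- field_h p / 2) * (exp (field_h p + l) - Lambda_plus p l))\<^sup>2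
    / (exp (- l) ^ 2 + (exp (field_h p + l) - Lambda_plus p l)\<^sup>2)"
proof -
  have "(norm (vec_w_plus p l))\<^sup>2 = exp (- l) ^ 2 + (exp (field_h p + l) - Lambda_plus p l)\<^sup>2"
    unfolding power2_norm_eq_inner vec_w_plus_def inner_vec_def by (simp add: sum_2 power2_eq_square)
  moreover have "vec_v p \<bullet> vec_w_plus p l
      = exp (field_h p / 2) * - exp (- l) + exp (- field_h p / 2) * (exp (field_h p + l) - Lambda_plus p l)"
    unfolding vec_v_def vec_w_plus_def inner_vec_def by (simp add: sum_2)
  moreover have "overlap l = (vec_v p \<bullet> vec_w_plus p l)\<^sup>2 / (norm (vec_w_plus p l))\<^sup>2"
    unfolding overlap_def vec_e_plus_def by (simp add: power_mult_distrib divide_inverse power_inverse)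
  ultimately show ?thesis by simp
qed

lemma overlap_pos: "0 < overlap l"
proof -
  have "exp (- field_h p / 2) * (exp (field_h p + l) - Lambda_plus p l) < 0"
    using exp_less_Lambda_plus[of l] by (intro mult_pos_neg) auto
  moreover have "exp (field_h p / 2) * - exp (- l) < 0" by simp
  ultimately have "exp (field_h p / 2) * - exp (- l) + exp (- field_h p / 2) * (exp (field_h p + l) - Lambda_plus p l) \<noteq> 0"
    by linarith
  then show ?thesis unfolding overlap_eq by (intro divide_pos_pos) (auto intro: add_pos_nonneg)
qed

text \<open>The spectral decomposition \<open>M - \<Lambda>\<^sub>- = (\<Lambda>\<^sub>+ - \<Lambda>\<^sub>-) e\<^sub>+ e\<^sub>+\<^sup>T\<close>, evaluated at \<open>v\<close>.\<close>

lemma overlap_mult_gap: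
  "overlap l * (Lambda_plus p l - Lambda_minus p l)
    = exp (field_h p) * (exp (l + field_h p) - Lambda_minus p l) + 2 * exp (- l)
      + exp (- field_h p) * (exp (l - field_h p) - Lambda_minus p l)"
proof -
  define a b d x y where "a = exp (l + field_h p)" and "b = exp (- l)" and "d = exp (l - field_h p)"
    and "x = Lambda_plus p l" and "y = Lambda_minus p l"
  define s t where "s = exp (field_h p / 2)" and "t = exp (- field_h p / 2)"
  have st: "s * t = 1" "s * s = exp (field_h p)" "t * t = exp (- field_h p)"
    by (simp_all add: s_def t_def exp_add[symmetric])
  have add: "x + y = a + d" using Lambda_add[of l] by (simp add: x_def y_def a_def d_def)
  have mult: "x * y = a * d - b * b"
    using Lambda_mult[of l] by (simp add: x_def y_def a_def d_def b_def exp_add[symmetric])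
  have n0: "b ^ 2 + (a - x) ^ 2 \<noteq> 0" 
    by (simp add: b_def add_pos_nonneg less_imp_neq[THEN not_sym])
  have y: "y = a + d - x" using add by simp
  have char: "x * x = x * (a + d) - a * d + b * b" using mult unfolding y by (simp add: algebra_simps)
  have "(s * - b + t * (a - x))\<^sup>2 * (x - y)
      = (exp (field_h p) * (a - y) + 2 * b + exp (- field_h p) * (d - y)) * (b ^ 2 + (a - x) ^ 2)"
  proof -
    \<comment> \<open>These are the entries of the spectral identity: the vector with entries
      \<open>- b\<close> and \<open>a - x\<close> is \<open>vec_w_plus\<close>, the matrix has
      entries \<open>a\<close>, \<open>b\<close>, \<open>b\<close>, \<open>d\<close>, and the common
      factor on the right is the squared norm of the vector.\<close>
    have e1: "b * b * (x - y) = (a - y) * (b ^ 2 + (a - x) ^ 2)"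
      and e2: "- b * (a - x) * (x - y) = b * (b ^ 2 + (a - x) ^ 2)"
      and e3: "(a - x) * (a - x) * (x - y) = (d - y) * (b ^ 2 + (a - x) ^ 2)"
      using char unfolding y by algebra+
    have "(s * - b + t * (a - x))\<^sup>2 * (x - y)
      = (s * s) * (b * b * (x - y)) + 2 * (s * t) * (- b * (a - x) * (x - y))
        + (t * t) * ((a - x) * (a - x) * (x - y))"
      by (simp add: power2_eq_square algebra_simps)
    also have "\<dots> = (exp (field_h p) * (a - y) + 2 * b + exp (- field_h p) * (d - y)) * (b ^ 2 + (a - x) ^ 2)"
      unfolding e1 e2 e3 st by (simp add: algebra_simps)
    finally show ?thesis .
  qed
  then have "(s * - b + t * (a - x))\<^sup>2 / (b ^ 2 + (a - x) ^ 2) * (x - y)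
      = exp (field_h p) * (a - y) + 2 * b + exp (- field_h p) * (d - y)"
    using n0 by (simp add: field_simps)
  then show ?thesis
    unfolding overlap_eq by (simp add: s_def t_def a_def b_def d_def x_def y_def add.commute)
qed

text \<open>By Cayley-Hamilton \<open>a n + b n\<close> satisfies a two-term linear recursion given
  by trace and determinant. The right-hand side satisfies the same recursion, so agreement at 0 and
  1 suffices: at 0 it is the normalisation of the spin weights, at 1 it is the value of
  \<open>v^T M v\<close> supplied by \<open>overlap_mult_gap\<close>.\<close>

lemma transfer_matrix_power:
  fixes a b :: "nat \<Rightarrow> real"
  assumes "a 0 = p" "b 0 = 1 - p"
    and a: "\<And>n. a (Suc n) = p * (exp l * a n + exp (- l) * b n)"
    and b: "\<And>n. b (Suc n) = (1 - p) * (exp (- l) * a n + exp l * b n)"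
  shows "a n + b n = sqrt (p * (1 - p)) ^ Suc n *
    (overlap l * Lambda_plus p l ^ n + (2 * cosh (field_h p) - overlap l) * Lambda_minus p l ^ n)"
proof -
  define r where "r = sqrt (p * (1 - p))"
  define x y where "x = Lambda_plus p l" and "y = Lambda_minus p l"
  define \<alpha> \<beta> where "\<alpha> = overlap l" and "\<beta> = 2 * cosh (field_h p) - overlap l"
  have r2: "r * r = p * (1 - p)" using p by (simp add: r_def)
  have rh: "r * exp (field_h p) = p" "r * exp (- field_h p) = 1 - p"
    using sqrt_mult_exp_field_h by (simp_all add: r_def)
  have add: "r * (x + y) = exp l"
  proof -
    have "r * (x + y) = exp l * (r * exp (field_h p) + r * exp (- field_h p))"
      unfolding x_def y_def Lambda_add by (simp add: exp_add exp_diff exp_minus algebra_simps divide_inverse)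
    then show ?thesis unfolding rh by simp
  qed
  have mult: "r * r * (x * y) = p * (1 - p) * (exp l ^ 2 - exp (- l) ^ 2)"
    unfolding x_def y_def Lambda_mult r2 by (simp add: exp_double[symmetric])
  have rec: "a (Suc (Suc n)) + b (Suc (Suc n))
      = exp l * (a (Suc n) + b (Suc n)) - p * (1 - p) * (exp l ^ 2 - exp (- l) ^ 2) * (a n + b n)" for n
    unfolding a b by algebra
  have Zrec: "r ^ Suc (Suc (Suc n)) * (\<alpha> * x ^ Suc (Suc n) + \<beta> * y ^ Suc (Suc n))
      = r * (x + y) * (r ^ Suc (Suc n) * (\<alpha> * x ^ Suc n + \<beta> * y ^ Suc n))
        - r * r * (x * y) * (r ^ Suc n * (\<alpha> * x ^ n + \<beta> * y ^ n))" for n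
    by (simp add: algebra_simps)
  have "a n + b n = r ^ Suc n * (\<alpha> * x ^ n + \<beta> * y ^ n)"
  proof (induction n rule: induct_nat_012)
    case 0
    then show ?case
      using sqrt_mult_two_cosh_field_h assms(1,2) by (simp add: \<alpha>_def \<beta>_def r_def)
  next
    case 1
    have "r ^ Suc 1 * (\<alpha> * x ^ 1 + \<beta> * y ^ 1) = r * r * (\<alpha> * (x - y) + 2 * cosh (field_h p) * y)"
      by (simp add: \<alpha>_def \<beta>_def algebra_simps)
    also have "\<alpha> * (x - y) + 2 * cosh (field_h p) * y
        = exp (field_h p) * exp (l + field_h p) + 2 * exp (- l) + exp (- field_h p) * exp (l - field_h p)"
      using overlap_mult_gap[of l] by (simp add: \<alpha>_def x_def y_def cosh_def algebra_simps)
    also have "\<dots> = exp l * (exp (field_h p) * exp (field_h p)) + 2 * exp (- l) + exp l * (exp (- field_h p) * exp (- field_h p))"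
      by (simp add: exp_add exp_diff exp_minus divide_inverse)
    also have "r * r * \<dots> = exp l * ((r * exp (field_h p)) * (r * exp (field_h p))) + 2 * (r * r) * exp (- l)
        + exp l * ((r * exp (- field_h p)) * (r * exp (- field_h p)))"
      by (simp only: distrib_left mult_ac)
    also have "\<dots> = a 1 + b 1"
      unfolding rh r2 One_nat_def a b assms(1,2) by (simp add: algebra_simps)
    finally show ?case by simp
  next
    case (ge2 n)
    show ?case unfolding rec ge2 Zrec add mult ..
  qed
  then show ?thesis by (simp add: r_def \<alpha>_def \<beta>_def x_def y_def)
qed

text \<open>A chain with \<open>m + 1\<close> bonds contributes one factor \<open>overlap\<close>,
  \<open>m + 1\<close> factors \<open>Lambda_plus\<close> and \<open>m + 2\<close> factors
  \<open>sqrt (p * (1 - p))\<close>. The three sums are the resulting total exponents, whence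
  \<open>3/4\<close> for \<open>p * (1 - p)\<close>, and the power 1 of the inner product, since
  \<open>overlap\<close> is its square.\<close>

lemma dyadic_sums:
  "(\<lambda>m. 1 / 2 ^ (m + 2)) sums (1 / 2 :: real)"
  "(\<lambda>m. real (m + 1) / 2 ^ (m + 2)) sums 1"
  "(\<lambda>m. real (m + 2) / 2 ^ (m + 2)) sums (3 / 2)"
proof -
  show 1: "(\<lambda>m. 1 / 2 ^ (m + 2)) sums (1 / 2 :: real)"
    using sums_mult[OF geometric_sums[of "1 / 2 :: real"], of "1 / 4"]
    by (simp add: power_divide field_simps)
  show 2: "(\<lambda>m. real (m + 1) / 2 ^ (m + 2)) sums 1"
    using sums_mult[OF geometric_deriv_sums[of "1 / 2 :: real"], of "1 / 4"]
    by (simp add: power_divide field_simps)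
  have "(\<lambda>m. real (m + 1) / 2 ^ (m + 2) + 1 / 2 ^ (m + 2)) sums (1 + 1 / 2)"
    by (intro sums_add 1 2)
  then show "(\<lambda>m. real (m + 2) / 2 ^ (m + 2)) sums (3 / 2)"
    by (simp add: add_divide_distrib[symmetric] add_ac)
qed

text \<open>Factoring out the leading term of \<open>Z (Suc m)\<close> leaves \<open>g m\<close>,
  the argument of the logarithm in \<open>cal_G\<close>. Positivity of \<open>g m\<close> and
  summability of its logarithms are inherited from \<open>Z\<close>, which avoids estimating powers
  of a ratio that is negative for negative \<open>l\<close>.\<close>

lemma cal_F_sums:
  fixes Z :: "nat \<Rightarrow> real"
  assumes Z_pos: "\<And>n. 0 < Z n"
    and Z: "\<And>n. Z n = sqrt (p * (1 - p)) ^ Suc n *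
    (overlap l * Lambda_plus p l ^ n + (2 * cosh (field_h p) - overlap l) * Lambda_minus p l ^ n)"
    and summable: "summable (\<lambda>m. ln (Z (Suc m)) / 2 ^ (m + 2))"
  shows "(\<lambda>m. ln (Z (Suc m)) / 2 ^ (m + 2)) sums cal_F p l"
proof -
  define r where "r = sqrt (p * (1 - p))"
  define g where "g m = 1 + (2 * cosh (field_h p) / overlap l - 1) * (Lambda_minus p l / Lambda_plus p l) ^ Suc m" for m
  have r: "r > 0" using p by (simp add: r_def)
  note pos = overlap_pos[of l] Lambda_plus_pos[of l] r
  have Zg: "Z (Suc m) = r ^ (m + 2) * overlap l * Lambda_plus p l ^ Suc m * g m" for m
    unfolding Z g_def r_def[symmetric] power_divide using pos by (simp add: field_simps)
  have g_pos: "0 < g m" for m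
  proof -
    have "0 < (r ^ (m + 2) * overlap l * Lambda_plus p l ^ Suc m) * g m" using Z_pos[of "Suc m"] Zg[of m] by simp
    moreover have "0 < r ^ (m + 2) * overlap l * Lambda_plus p l ^ Suc m" using pos by simp
    ultimately show ?thesis using zero_less_mult_pos by blast
  qed
  define f where "f m = real (m + 2) / 2 ^ (m + 2) * ln r + 1 / 2 ^ (m + 2) * ln (overlap l)
      + real (m + 1) / 2 ^ (m + 2) * ln (Lambda_plus p l)" for m
  have lnZ: "ln (Z (Suc m)) / 2 ^ (m + 2) = f m + ln (g m) / 2 ^ (m + 2)" for m
  proof -
    have "ln (Z (Suc m)) = real (m + 2) * ln r + ln (overlap l) + real (m + 1) * ln (Lambda_plus p l) + ln (g m)"
      unfolding Zg using pos g_pos[of m] by (simp add: ln_mult ln_realpow algebra_simps)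
    then show ?thesis unfolding f_def by (simp only: add_divide_distrib times_divide_eq_left mult_1)
  qed
  have f: "f sums (3 / 2 * ln r + 1 / 2 * ln (overlap l) + 1 * ln (Lambda_plus p l))"
    unfolding f_def by (intro sums_add sums_mult2 dyadic_sums)
  have "summable (\<lambda>m. ln (g m) / 2 ^ (m + 2))"
    using summable_diff[OF summable sums_summable[OF f]] unfolding lnZ by (simp only: add_diff_cancel_left')
  then have g: "summable (\<lambda>m. 1 / 2 ^ Suc m * ln (g m))"
    using summable_mult[of "\<lambda>m. ln (g m) / 2 ^ (m + 2)" 2] by (simp add: field_simps)
  have "(\<lambda>m. 1 / 2 * (1 / 2 ^ Suc m * ln (g m))) sums cal_G p l"
    unfolding cal_G_def using sums_mult[OF summable_sums[OF g], of "1 / 2"] by (simp add: g_def overlap_def)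
  then have "(\<lambda>m. ln (g m) / 2 ^ (m + 2)) sums cal_G p l" by (simp add: field_simps)
  from sums_add[OF f this]
  have "(\<lambda>m. ln (Z (Suc m)) / 2 ^ (m + 2)) sums
      (3 / 2 * ln r + 1 / 2 * ln (overlap l) + 1 * ln (Lambda_plus p l) + cal_G p l)"
    unfolding lnZ .
  also have "3 / 2 * ln r + 1 / 2 * ln (overlap l) + 1 * ln (Lambda_plus p l) + cal_G p l = cal_F p l"
  proof -
    define A where "A = \<bar>vec_v p \<bullet> vec_e_plus p l\<bar>"
    have o: "overlap l = A\<^sup>2" by (simp add: overlap_def A_def)
    then have "A \<noteq> 0" using overlap_pos[of l] by auto
    then have "A > 0" by (simp add: A_def)
    then show ?thesis
      using p Lambda_plus_pos[of l]
      by (simp add: cal_F_def A_def[symmetric] o ln_mult ln_powr r_def ln_sqrt ln_realpow)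
  qed
  finally show ?thesis .
qed

end

section \<open>Sums over chains of independent spins\<close>

locale bernoulli_spins = prob_space M for M :: "'a measure" +
  fixes p :: real and \<sigma> :: "nat \<Rightarrow> 'a \<Rightarrow> real"
  assumes p: "0 < p" "p < 1"
    and spin_range: "\<And>i \<omega>. 1 \<le> i \<Longrightarrow> \<omega> \<in> space M \<Longrightarrow> \<sigma> i \<omega> \<in> {-1, 1}"
    and spin_indep: "indep_vars (\<lambda>_. borel) \<sigma> {1..}"
    and spin_plus: "\<And>i. 1 \<le> i \<Longrightarrow> prob {\<omega> \<in> space M. \<sigma> i \<omega> = 1} = p"
    and spin_minus: "\<And>i. 1 \<le> i \<Longrightarrow> prob {\<omega> \<in> space M. \<sigma> i \<omega> = -1} = 1 - p"
begin

lemma spin_measurable: "1 \<le> i \<Longrightarrow> \<sigma> i \<in> borel_measurable M"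
  using spin_indep unfolding indep_vars_def2 by auto

definition chain :: "nat \<Rightarrow> nat \<Rightarrow> 'a \<Rightarrow> real" where
  "chain k n \<omega> = (\<Sum>j<n. \<sigma> (k * 2 ^ j) \<omega> * \<sigma> (k * 2 ^ Suc j) \<omega>)"

lemma chain_measurable [measurable]: "0 < k \<Longrightarrow> chain k n \<in> borel_measurable M"
  unfolding chain_def[abs_def] by (intro borel_measurable_sum borel_measurable_times spin_measurable) auto

lemma abs_chain_le:
  assumes "0 < k" "\<omega> \<in> space M" shows "\<bar>chain k n \<omega>\<bar> \<le> real n"
proof -
  have "\<bar>chain k n \<omega>\<bar> \<le> (\<Sum>j<n. \<bar>\<sigma> (k * 2 ^ j) \<omega> * \<sigma> (k * 2 ^ Suc j) \<omega>\<bar>)"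
    unfolding chain_def by (rule sum_abs)
  also have "\<dots> \<le> (\<Sum>j<n. 1)"
  proof (rule sum_mono)
    fix j
    show "\<bar>\<sigma> (k * 2 ^ j) \<omega> * \<sigma> (k * 2 ^ Suc j) \<omega>\<bar> \<le> 1"
      using assms spin_range[of "k * 2 ^ j" \<omega>] spin_range[of "k * 2 ^ Suc j" \<omega>] by (auto simp: abs_mult)
  qed
  finally show ?thesis by simp
qed

lemma chain_in_int_range:
  assumes "0 < k" "\<omega> \<in> space M" shows "chain k n \<omega> \<in> of_int ` {- int n..int n}"
proof -
  have "chain k n \<omega> \<in> \<int>"
    unfolding chain_def
  proof (rule Ints_sum)
    fix j
    show "\<sigma> (k * 2 ^ j) \<omega> * \<sigma> (k * 2 ^ Suc j) \<omega> \<in> \<int>"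
      using assms spin_range[of "k * 2 ^ j" \<omega>] spin_range[of "k * 2 ^ Suc j" \<omega>] by auto
  qed
  then obtain i where i: "chain k n \<omega> = of_int i" by (auto elim: Ints_cases)
  then have "i \<in> {- int n..int n}"
    using abs_chain_le[OF assms, of n] by (auto simp: abs_le_iff)
  then show ?thesis using i by blast
qed

text \<open>All chains of the same length have the same law, so the one starting at site 1 serves as a model.\<close>

definition model_chain :: "nat \<Rightarrow> 'a \<Rightarrow> real" where
  "model_chain = chain 1"

lemma model_chain_measurable [measurable]: "model_chain n \<in> borel_measurable M"
  by (simp add: model_chain_def chain_measurable)

sublocale base: finite_range_variable M "model_chain n" "of_int ` {- int n..int n}" "real n" for n
  unfolding model_chain_def by unfold_locales (auto intro!: chain_in_int_range chain_measurable)

section \<open>The transfer recursion for a single chain\<close>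

lemma chain_cong:
  assumes "\<And>j. j \<le> n \<Longrightarrow> x (k * 2 ^ j) = \<sigma> (k * 2 ^ j) \<omega>"
  shows "(\<Sum>j<n. x (k * 2 ^ j) * x (k * 2 ^ Suc j)) = chain k n \<omega>"
  unfolding chain_def using assms by (intro sum.cong) (auto simp del: power_Suc)

text \<open>Recording the last spin turns the exponential transform into the state vector of the
  transfer matrix. The type is generic because real \<open>z\<close> gives cumulants and imaginary
  \<open>z\<close> gives characteristic functions.\<close>

definition end_transform :: "'b::{real_normed_field, banach, second_countable_topology} \<Rightarrow> nat \<Rightarrow> nat \<Rightarrow> real \<Rightarrow> 'b" where
  "end_transform z k n s =
    expectation (\<lambda>\<omega>. exp (z * of_real (chain k n \<omega>)) * of_real (indicator {s} (\<sigma> (k * 2 ^ n) \<omega>)))"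

lemma integrable_exp_chain:
  fixes z :: "'b::{real_normed_field, banach, second_countable_topology}"
  assumes "0 < k"
  shows "integrable M (\<lambda>\<omega>. exp (z * of_real (chain k n \<omega>)))"
proof (rule integrable_const_bound[where B = "exp (norm z * real n)"])
  note [measurable] = chain_measurable[OF assms]
  show "(\<lambda>\<omega>. exp (z * of_real (chain k n \<omega>))) \<in> borel_measurable M" by measurable
  show "AE \<omega> in M. norm (exp (z * of_real (chain k n \<omega>))) \<le> exp (norm z * real n)"
  proof (rule AE_I2)
    fix \<omega> assume "\<omega> \<in> space M"
    have "norm (exp (z * of_real (chain k n \<omega>))) \<le> exp (norm (z * of_real (chain k n \<omega>)))" by (rule norm_exp)
    also have "\<dots> \<le> exp (norm z * real n)"
      using abs_chain_le[OF assms \<open>\<omega> \<in> space M\<close>, of n] by (simp add: norm_mult mult_left_mono)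
    finally show "norm (exp (z * of_real (chain k n \<omega>))) \<le> exp (norm z * real n)" .
  qed
qed

lemma integrable_end_transform:
  fixes z :: "'b::{real_normed_field, banach, second_countable_topology}"
  assumes "0 < k"
  shows "integrable M (\<lambda>\<omega>. exp (z * of_real (chain k n \<omega>)) * of_real (indicator {s} (\<sigma> (k * 2 ^ n) \<omega>)))"
proof (rule Bochner_Integration.integrable_bound[OF integrable_exp_chain[OF assms, of z n]])
  note [measurable] = chain_measurable[OF assms]
  have [measurable]: "\<sigma> (k * 2 ^ n) \<in> borel_measurable M" using assms by (intro spin_measurable) simp
  show "(\<lambda>\<omega>. exp (z * of_real (chain k n \<omega>)) * of_real (indicator {s} (\<sigma> (k * 2 ^ n) \<omega>))) \<in> borel_measurable M"
    by measurable
  show "AE \<omega> in M. norm (exp (z * of_real (chain k n \<omega>)) * of_real (indicator {s} (\<sigma> (k * 2 ^ n) \<omega>)))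
      \<le> norm (exp (z * of_real (chain k n \<omega>)))"
    by (intro AE_I2) (auto simp: indicator_def norm_mult)
qed

definition spin_prob :: "real \<Rightarrow> real" where
  "spin_prob s = (if s = 1 then p else 1 - p)"

lemma prob_spin: "1 \<le> i \<Longrightarrow> s \<in> {-1, 1} \<Longrightarrow> prob {\<omega> \<in> space M. \<sigma> i \<omega> = s} = spin_prob s"
  using spin_plus spin_minus by (auto simp: spin_prob_def)

lemma expectation_spin_indicator:
  assumes "1 \<le> i" "s \<in> {-1, 1}"
  shows "expectation (\<lambda>\<omega>. of_real (indicator {s} (\<sigma> i \<omega>)) :: 'b::{real_normed_field, banach, second_countable_topology})
    = of_real (spin_prob s)"
proof -
  have "expectation (\<lambda>\<omega>. of_real (indicator {s} (\<sigma> i \<omega>)) :: 'b)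
      = of_real (expectation (\<lambda>\<omega>. indicator {s} (\<sigma> i \<omega>)))"
    using spin_measurable[OF assms(1)]
    by (intro integral_of_real integrable_const_bound[where B = 1]) (auto simp: indicator_def)
  also have "(expectation (\<lambda>\<omega>. indicator {s} (\<sigma> i \<omega>)) :: real) = expectation (indicator {\<omega> \<in> space M. \<sigma> i \<omega> = s})"
    by (rule Bochner_Integration.integral_cong) (auto simp: indicator_def)
  also have "\<dots> = spin_prob s"
    using prob_spin[OF assms] by (simp add: Int_absorb2 subset_eq)
  finally show ?thesis .
qed

lemma end_transform_0:
  assumes "0 < k" "s \<in> {-1, 1}"
  shows "end_transform z k 0 s = of_real (spin_prob s)"
  using expectation_spin_indicator[of k s] assms by (simp add: end_transform_def chain_def)

text \<open>Once the new end spin is fixed to \<open>s\<close>, the new bond depends only on the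
  previous end spin, and the new spin is independent of all earlier ones.\<close>

lemma end_transform_Suc:
  fixes z :: "'b::{real_normed_field, banach, second_countable_topology}"
  assumes k: "0 < k" and s: "s \<in> {-1, 1}"
  shows "end_transform z k (Suc n) s = of_real (spin_prob s) *
    (exp (z * of_real s) * end_transform z k n 1 + exp (- (z * of_real s)) * end_transform z k n (-1))"
proof -
  define A B where "A = (\<lambda>j. k * 2 ^ j) ` {..n}" and "B = {k * 2 ^ Suc n}"
  define P where "P = (\<lambda>A. \<lambda>\<omega>. restrict (\<lambda>i. \<sigma> i \<omega>) A)"
  \<comment> \<open>The factor of the new bond is placed in \<open>g1\<close> with \<open>s\<close>
    in place of the new spin. The indicator in \<open>g2\<close> makes this harmless and lets the
    expectation factorise.\<close>
  define g1 :: "(nat \<Rightarrow> real) \<Rightarrow> 'b" where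
    "g1 x = exp (z * of_real (\<Sum>j<n. x (k * 2 ^ j) * x (k * 2 ^ Suc j))) *
      (exp (z * of_real s) * of_real (indicator {1} (x (k * 2 ^ n)))
        + exp (- (z * of_real s)) * of_real (indicator {-1} (x (k * 2 ^ n))))" for x
  define g2 :: "(nat \<Rightarrow> real) \<Rightarrow> 'b" where "g2 x = of_real (indicator {s} (x (k * 2 ^ Suc n)))" for x
  have "indep_var (PiM A (\<lambda>_. borel)) (P A) (PiM B (\<lambda>_. borel)) (P B)"
    unfolding P_def using k
    by (intro indep_var_restrict[OF spin_indep]) (auto simp: A_def B_def simp del: power_Suc)
  moreover have "g1 \<in> borel_measurable (PiM A (\<lambda>_. borel))"
  proof -
    have [measurable]: "(\<lambda>x. x (k * 2 ^ j)) \<in> borel_measurable (PiM A (\<lambda>_. borel :: real measure))" if "j \<le> n" for j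
      using that by (intro measurable_component_singleton) (auto simp: A_def)
    have [measurable]: "(\<lambda>x. (\<Sum>j<n. x (k * 2 ^ j) * x (k * 2 ^ Suc j))) \<in> borel_measurable (PiM A (\<lambda>_. borel :: real measure))"
      by (intro borel_measurable_sum borel_measurable_times) (auto simp del: power_Suc)
    show ?thesis unfolding g1_def[abs_def] by measurable
  qed
  moreover have "g2 \<in> borel_measurable (PiM B (\<lambda>_. borel))"
  proof -
    have [measurable]: "(\<lambda>x. x (k * 2 ^ Suc n)) \<in> borel_measurable (PiM B (\<lambda>_. borel :: real measure))"
      by (intro measurable_component_singleton) (auto simp: B_def)
    show ?thesis unfolding g2_def[abs_def] by measurable
  qed
  ultimately have indep: "indep_var borel (g1 \<circ> P A) borel (g2 \<circ> P B)"
    by (rule indep_var_compose)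
  have g1: "(g1 \<circ> P A) \<omega> = exp (z * of_real s) * (exp (z * of_real (chain k n \<omega>)) * of_real (indicator {1} (\<sigma> (k * 2 ^ n) \<omega>)))
      + exp (- (z * of_real s)) * (exp (z * of_real (chain k n \<omega>)) * of_real (indicator {-1} (\<sigma> (k * 2 ^ n) \<omega>)))" for \<omega>
  proof -
    have "(\<Sum>j<n. P A \<omega> (k * 2 ^ j) * P A \<omega> (k * 2 ^ Suc j)) = chain k n \<omega>"
      by (rule chain_cong) (auto simp: P_def A_def)
    moreover have "P A \<omega> (k * 2 ^ n) = \<sigma> (k * 2 ^ n) \<omega>" by (auto simp: P_def A_def)
    ultimately show ?thesis unfolding comp_def g1_def by (simp add: algebra_simps)
  qed
  have g2: "(g2 \<circ> P B) \<omega> = of_real (indicator {s} (\<sigma> (k * 2 ^ Suc n) \<omega>))" for \<omega>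
    by (simp add: g2_def P_def B_def)
  have int1: "integrable M (g1 \<circ> P A)"
    by (subst g1[THEN ext])
       (intro Bochner_Integration.integrable_add integrable_mult_right integrable_end_transform k)
  have [measurable]: "\<sigma> (k * 2 ^ Suc n) \<in> borel_measurable M" using k by (intro spin_measurable) simp
  have int2: "integrable M (g2 \<circ> P B)"
    by (subst g2[THEN ext], rule integrable_const_bound[where B = 1], simp add: indicator_def, measurable)
  have "end_transform z k (Suc n) s = expectation (\<lambda>\<omega>. (g1 \<circ> P A) \<omega> * (g2 \<circ> P B) \<omega>)"
    unfolding end_transform_def
  proof (rule Bochner_Integration.integral_cong)
    fix \<omega> assume \<omega>: "\<omega> \<in> space M"
    have ch: "chain k (Suc n) \<omega> = chain k n \<omega> + \<sigma> (k * 2 ^ n) \<omega> * \<sigma> (k * 2 ^ Suc n) \<omega>" by (simp add: chain_def)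
    show "exp (z * of_real (chain k (Suc n) \<omega>)) * of_real (indicator {s} (\<sigma> (k * 2 ^ Suc n) \<omega>))
      = (g1 \<circ> P A) \<omega> * (g2 \<circ> P B) \<omega>"
    proof (cases "\<sigma> (k * 2 ^ Suc n) \<omega> = s")
      case True
      have "\<sigma> (k * 2 ^ n) \<omega> = 1 \<or> \<sigma> (k * 2 ^ n) \<omega> = -1" using spin_range[of "k * 2 ^ n" \<omega>] k \<omega> by auto
      then show ?thesis
      proof
        assume 1: "\<sigma> (k * 2 ^ n) \<omega> = 1"
        have "exp (z * of_real (chain k (Suc n) \<omega>)) = exp (z * of_real s) * exp (z * of_real (chain k n \<omega>))"
          unfolding ch True 1 by (simp add: exp_add[symmetric] algebra_simps)
        then show ?thesis unfolding g1 g2 True 1 by simp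
      next
        assume 1: "\<sigma> (k * 2 ^ n) \<omega> = -1"
        have "exp (z * of_real (chain k (Suc n) \<omega>)) = exp (- (z * of_real s)) * exp (z * of_real (chain k n \<omega>))"
          unfolding ch True 1 by (simp add: exp_add[symmetric] algebra_simps)
        then show ?thesis unfolding g1 g2 True 1 by simp
      qed
    next
      case False
      then show ?thesis unfolding g1 g2 by simp
    qed
  qed simp
  also have "\<dots> = expectation (g1 \<circ> P A) * expectation (g2 \<circ> P B)"
    by (rule indep_var_lebesgue_integral[OF indep int1 int2])
  also have "expectation (g2 \<circ> P B) = of_real (spin_prob s)"
    using expectation_spin_indicator[of "k * 2 ^ Suc n" s] k s by (subst g2[THEN ext]) simp
  also have "expectation (g1 \<circ> P A)
      = exp (z * of_real s) * end_transform z k n 1 + exp (- (z * of_real s)) * end_transform z k n (-1)"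
    using integrable_end_transform[OF k, of z n]
    by (subst g1[THEN ext]) (simp add: end_transform_def)
  finally show ?thesis by (simp add: mult.commute)
qed

lemma expectation_exp_chain:
  fixes z :: "'b::{real_normed_field, banach, second_countable_topology}"
  assumes k: "0 < k"
  shows "expectation (\<lambda>\<omega>. exp (z * of_real (chain k n \<omega>))) = end_transform z k n 1 + end_transform z k n (-1)"
proof -
  have "expectation (\<lambda>\<omega>. exp (z * of_real (chain k n \<omega>)))
    = expectation (\<lambda>\<omega>. exp (z * of_real (chain k n \<omega>)) * of_real (indicator {1} (\<sigma> (k * 2 ^ n) \<omega>))
       + exp (z * of_real (chain k n \<omega>)) * of_real (indicator {-1} (\<sigma> (k * 2 ^ n) \<omega>)))"
  proof (rule Bochner_Integration.integral_cong)
    fix \<omega> assume "\<omega> \<in> space M"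
    then have "\<sigma> (k * 2 ^ n) \<omega> = 1 \<or> \<sigma> (k * 2 ^ n) \<omega> = -1" using spin_range[of "k * 2 ^ n" \<omega>] k by auto
    then show "exp (z * of_real (chain k n \<omega>)) = exp (z * of_real (chain k n \<omega>)) * of_real (indicator {1} (\<sigma> (k * 2 ^ n) \<omega>))
       + exp (z * of_real (chain k n \<omega>)) * of_real (indicator {-1} (\<sigma> (k * 2 ^ n) \<omega>))" by auto
  qed simp
  also have "\<dots> = end_transform z k n 1 + end_transform z k n (-1)"
    unfolding end_transform_def by (rule Bochner_Integration.integral_add) (intro integrable_end_transform k)+
  finally show ?thesis .
qed

section \<open>Equal laws and independence of the chains\<close>

lemma end_transform_shift:
  assumes "0 < k" "0 < k'" "s \<in> {-1, 1}"
  shows "end_transform z k n s = end_transform z k' n s"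
  using assms(3)
proof (induction n arbitrary: s)
  case 0
  then show ?case using assms(1,2) by (simp add: end_transform_0)
next
  case (Suc n)
  then show ?case using assms(1,2) by (simp add: end_transform_Suc)
qed

text \<open>The recursion and its initial value are the same for every positive starting point, so
  the characteristic functions coincide.\<close>

lemma distr_chain:
  assumes k: "0 < k" shows "distr M borel (chain k n) = distr M borel (model_chain n)"
proof (rule Levy_uniqueness)
  show "real_distribution (distr M borel (chain k n))" "real_distribution (distr M borel (model_chain n))"
    using chain_measurable[OF k] by (auto intro!: real_distribution_distr)
  show "char (distr M borel (chain k n)) = char (distr M borel (model_chain n))"
  proof
    fix t
    have char: "char (distr M borel (chain k n)) t
        = end_transform (\<i> * of_real t) k n 1 + end_transform (\<i> * of_real t) k n (-1)" if "0 < k" for k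
    proof -
      have "char (distr M borel (chain k n)) t = expectation (\<lambda>\<omega>. exp (\<i> * of_real t * of_real (chain k n \<omega>)))"
        using chain_measurable[OF that, of n] unfolding char_def by (subst integral_distr) (auto simp: mult.assoc)
      then show ?thesis by (simp only: expectation_exp_chain[OF that])
    qed
    show "char (distr M borel (chain k n)) t = char (distr M borel (model_chain n)) t"
      unfolding model_chain_def char[OF k] char[OF zero_less_one]
      by (simp del: One_nat_def add: end_transform_shift[OF k zero_less_one])
  qed
qed

lemma expectation_chain_eq:
  fixes f :: "real \<Rightarrow> 'b::{banach, second_countable_topology}"
  assumes "0 < k" "f \<in> borel_measurable borel"
  shows "expectation (\<lambda>\<omega>. f (chain k n \<omega>)) = expectation (\<lambda>\<omega>. f (model_chain n \<omega>))"
proof -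
  have "expectation (\<lambda>\<omega>. f (chain k n \<omega>)) = (\<integral>x. f x \<partial>distr M borel (chain k n))"
    using assms chain_measurable by (intro integral_distr[symmetric]) auto
  also have "\<dots> = expectation (\<lambda>\<omega>. f (model_chain n \<omega>))"
    unfolding distr_chain[OF assms(1)] using assms by (intro integral_distr) auto
  finally show ?thesis .
qed

lemma odds_upto_pos: "k \<in> odds_upto N \<Longrightarrow> 0 < k"
  by (auto simp: odds_upto_def odd_pos)

lemma indep_chains: "indep_vars (\<lambda>_. borel) (\<lambda>k. chain k (chain_len N k)) (odds_upto N)"
proof -
  \<comment> \<open>The upper end is included: the last bond reaches the site
    \<open>k * 2 ^ chain_len N k\<close>. The sets remain disjoint because the odd parts
    differ.\<close>
  define K where "K k = (\<lambda>j. k * 2 ^ j) ` {..chain_len N k}" for k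
  have "indep_vars (\<lambda>k. PiM (K k) (\<lambda>_. borel)) (\<lambda>k \<omega>. restrict (\<lambda>i. \<sigma> i \<omega>) (K k)) (odds_upto N)"
  proof (rule indep_vars_restrict[OF spin_indep])
    show "K k \<subseteq> {1..}" if "k \<in> odds_upto N" for k
      using odds_upto_pos[OF that] by (auto simp: K_def Suc_le_eq)
    show "disjoint_family_on K (odds_upto N)"
      unfolding disjoint_family_on_def
    proof (intro ballI impI)
      fix k k' assume k: "k \<in> odds_upto N" "k' \<in> odds_upto N" "k \<noteq> k'"
      have "k * 2 ^ i \<noteq> k' * 2 ^ j" for i j
        using odd_mult_power_two_inj[of k k' i j] k by (auto simp: odds_upto_def)
      then show "K k \<inter> K k' = {}" by (auto simp: K_def)
    qed
  qed
  then have "indep_vars (\<lambda>_. borel)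
      (\<lambda>k \<omega>. (\<lambda>x. \<Sum>j<chain_len N k. x (k * 2 ^ j) * x (k * 2 ^ Suc j)) (restrict (\<lambda>i. \<sigma> i \<omega>) (K k))) (odds_upto N)"
  proof (rule indep_vars_compose2)
    fix k
    have "(\<lambda>x. x (k * 2 ^ j)) \<in> borel_measurable (PiM (K k) (\<lambda>_. borel :: real measure))" if "j \<le> chain_len N k" for j
      using that by (intro measurable_component_singleton) (auto simp: K_def)
    then show "(\<lambda>x. \<Sum>j<chain_len N k. x (k * 2 ^ j) * x (k * 2 ^ Suc j)) \<in> borel_measurable (PiM (K k) (\<lambda>_. borel :: real measure))"
      by (intro borel_measurable_sum borel_measurable_times) (auto simp del: power_Suc)
  qed
  moreover have "(\<lambda>k \<omega>. (\<lambda>x. \<Sum>j<chain_len N k. x (k * 2 ^ j) * x (k * 2 ^ Suc j)) (restrict (\<lambda>i. \<sigma> i \<omega>) (K k)))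
      = (\<lambda>k. chain k (chain_len N k))"
    by (intro ext chain_cong) (auto simp: K_def)
  ultimately show ?thesis by simp
qed

section \<open>The limiting cumulant generating function of \<open>S_sum\<close>\<close>

lemma S_sum_eq_chains: "S_sum \<sigma> N \<omega> = (\<Sum>k\<in>odds_upto N. chain k (chain_len N k) \<omega>)"
  unfolding S_sum_def chain_def by (subst sum_chains) (simp add: mult_ac)

lemma S_sum_measurable [measurable]: "S_sum \<sigma> N \<in> borel_measurable M"
  unfolding S_sum_def[abs_def] by (intro borel_measurable_sum borel_measurable_times spin_measurable) auto

lemma mgf_S_sum:
  "expectation (\<lambda>\<omega>. exp (l * S_sum \<sigma> N \<omega>)) = exp (\<Sum>k\<in>odds_upto N. base.cgf (chain_len N k) l)"
proof -
  have "expectation (\<lambda>\<omega>. exp (l * S_sum \<sigma> N \<omega>))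
      = expectation (\<lambda>\<omega>. \<Prod>k\<in>odds_upto N. exp (l * chain k (chain_len N k) \<omega>))"
    unfolding S_sum_eq_chains by (simp add: sum_distrib_left exp_sum)
  also have "\<dots> = (\<Prod>k\<in>odds_upto N. expectation (\<lambda>\<omega>. exp (l * chain k (chain_len N k) \<omega>)))"
  proof (rule indep_vars_lebesgue_integral)
    show "indep_vars (\<lambda>_. borel) (\<lambda>k \<omega>. exp (l * chain k (chain_len N k) \<omega>)) (odds_upto N)"
      by (rule indep_vars_compose2[OF indep_chains, where Y = "\<lambda>k x. exp (l * x)"]) auto
    show "integrable M (\<lambda>\<omega>. exp (l * chain k (chain_len N k) \<omega>))" if "k \<in> odds_upto N" for k
      using integrable_exp_chain[OF odds_upto_pos[OF that], of l] by simp
  qed simp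
  also have "\<dots> = (\<Prod>k\<in>odds_upto N. exp (base.cgf (chain_len N k) l))"
    unfolding base.exp_cgf
    by (intro prod.cong refl expectation_chain_eq[where f = "\<lambda>x. exp (l * x)"]) (auto simp: odds_upto_pos)
  finally show ?thesis by (simp add: exp_sum)
qed

lemma summable_cgf: "summable (\<lambda>m. \<bar>base.cgf (Suc m) l\<bar> / 2 ^ m)"
proof (rule summable_comparison_test'[of "\<lambda>m. \<bar>l\<bar> * (real (Suc m) ^ 1 / 2 ^ m)" 0])
  show "summable (\<lambda>m. \<bar>l\<bar> * (real (Suc m) ^ 1 / 2 ^ m))"
    by (intro summable_mult summable_power_geometric)
  show "norm (\<bar>base.cgf (Suc m) l\<bar> / 2 ^ m) \<le> \<bar>l\<bar> * (real (Suc m) ^ 1 / 2 ^ m)" for m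
    using base.abs_cgf_le[of "Suc m" l] by (simp add: divide_right_mono)
qed

lemma cal_F_sums_cgf: "(\<lambda>m. base.cgf (Suc m) l / 2 ^ (m + 2)) sums cal_F p l"
proof -
  define Z where "Z n = expectation (\<lambda>\<omega>. exp (l * model_chain n \<omega>))" for n
  have cgf: "base.cgf n l = ln (Z n)" for n by (simp add: base.cgf_def Z_def)
  have sm: "summable (\<lambda>m. ln (Z (Suc m)) / 2 ^ (m + 2))"
  proof (rule summable_comparison_test'[OF summable_cgf[of l], of 0])
    fix m
    show "norm (ln (Z (Suc m)) / 2 ^ (m + 2)) \<le> \<bar>base.cgf (Suc m) l\<bar> / 2 ^ m"
      unfolding cgf[symmetric] by (simp add: field_simps)
  qed
  have "(\<lambda>m. ln (Z (Suc m)) / 2 ^ (m + 2)) sums cal_F p l"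
  proof (rule cal_F_sums[OF p _ _ sm])
    show "0 < Z n" for n using base.mgf_pos[of n l] by (simp add: Z_def base.tilted_moment_def)
    have Z: "Z n = end_transform l 1 n 1 + end_transform l 1 n (-1)" for n
      using expectation_exp_chain[of 1 l n] by (simp add: Z_def model_chain_def)
    show "Z n = sqrt (p * (1 - p)) ^ Suc n * (overlap p l * Lambda_plus p l ^ n
        + (2 * cosh (field_h p) - overlap p l) * Lambda_minus p l ^ n)" for n
      unfolding Z
      by (rule transfer_matrix_power[OF p]) (simp_all add: end_transform_0 end_transform_Suc spin_prob_def)
  qed
  then show ?thesis by (simp add: cgf)
qed

lemma cal_F_eq: "cal_F p = (\<lambda>l. \<Sum>m. base.cgf (Suc m) l / 2 ^ (m + 2))"
  using cal_F_sums_cgf by (auto simp: sums_iff)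

lemma scaled_cgf_S_sum_limit:
  "(\<lambda>N. ln (expectation (\<lambda>\<omega>. exp (l * (real N * (S_sum \<sigma> N \<omega> / real N))))) / real N) \<longlonglongrightarrow> cal_F p l"
proof -
  have "(\<lambda>N. (\<Sum>k\<in>odds_upto N. base.cgf (chain_len N k) l) / real N) \<longlonglongrightarrow> cal_F p l"
    using chain_average_tendsto[OF summable_cgf] by (simp add: cal_F_eq)
  moreover have "ln (expectation (\<lambda>\<omega>. exp (l * (real N * (S_sum \<sigma> N \<omega> / real N))))) / real N
    = (\<Sum>k\<in>odds_upto N. base.cgf (chain_len N k) l) / real N" for N
    by (cases "N = 0") (simp_all add: mgf_S_sum)
  ultimately show ?thesis by (simp only:)
qed

section \<open>Termwise differentiation and the limiting variance\<close>

lemma summable_dyadic_bounded: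
  fixes f :: "nat \<Rightarrow> real"
  assumes "\<And>m. \<bar>f m\<bar> \<le> real (Suc m) ^ q"
  shows "summable (\<lambda>m. f m / 2 ^ (m + 2))"
proof (rule summable_comparison_test'[OF summable_power_geometric[of q], of 0])
  fix m
  have "\<bar>f m\<bar> / 2 ^ (m + 2) \<le> real (Suc m) ^ q / 2 ^ m"
    using assms[of m] by (intro frac_le) auto
  then show "norm (f m / 2 ^ (m + 2)) \<le> real (Suc m) ^ q / 2 ^ m" by simp
qed

text \<open>The derivative bounds are uniform in \<open>l\<close>, so the Weierstrass test applies
  on the whole line and convergence of the original series at 0 suffices.\<close>

lemma dyadic_series_has_derivative:
  fixes f f' :: "nat \<Rightarrow> real \<Rightarrow> real"
  assumes deriv: "\<And>m l. (f m has_field_derivative f' m l) (at l)"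
    and bound: "\<And>m l. \<bar>f' m l\<bar> \<le> real (Suc m) ^ q"
    and summable: "summable (\<lambda>m. f m 0 / 2 ^ (m + 2))"
  shows "((\<lambda>l. \<Sum>m. f m l / 2 ^ (m + 2)) has_field_derivative (\<Sum>m. f' m l / 2 ^ (m + 2))) (at l)"
proof (rule has_field_derivative_series'(2)[where S = UNIV and ?x0.0 = 0])
  show "((\<lambda>l. f m l / 2 ^ (m + 2)) has_field_derivative f' m l / 2 ^ (m + 2)) (at l within UNIV)" for m l
    by (intro DERIV_cdivide deriv)
  show "uniformly_convergent_on UNIV (\<lambda>n l. \<Sum>m<n. f' m l / 2 ^ (m + 2))"
  proof (rule Weierstrass_m_test'[OF _ summable_power_geometric])
    fix m l
    have "\<bar>f' m l\<bar> / 2 ^ (m + 2) \<le> real (Suc m) ^ q / 2 ^ m"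
      using bound[of m l] by (intro frac_le) auto
    then show "norm (f' m l / 2 ^ (m + 2)) \<le> real (Suc m) ^ q / 2 ^ m" by simp
  qed
qed (use summable in auto)

lemma cal_F_has_derivative:
  "(cal_F p has_field_derivative (\<Sum>m. base.cgf_deriv (Suc m) l / 2 ^ (m + 2))) (at l)"
  unfolding cal_F_eq
proof (rule dyadic_series_has_derivative[where q = 1])
  show "(base.cgf (Suc m) has_field_derivative base.cgf_deriv (Suc m) l) (at l)" for m l
    by (rule base.cgf_has_derivative)
  show "\<bar>base.cgf_deriv (Suc m) l\<bar> \<le> real (Suc m) ^ 1" for m l
    using base.abs_cgf_deriv_le[of "Suc m" l] by simp
qed (rule sums_summable[OF cal_F_sums_cgf])

lemma deriv_cal_F: "deriv (cal_F p) = (\<lambda>l. \<Sum>m. base.cgf_deriv (Suc m) l / 2 ^ (m + 2))"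
  using cal_F_has_derivative by (intro ext DERIV_imp_deriv)

lemma deriv_cal_F_has_derivative:
  "(deriv (cal_F p) has_field_derivative (\<Sum>m. base.cgf_deriv2 (Suc m) l / 2 ^ (m + 2))) (at l)"
  unfolding deriv_cal_F
proof (rule dyadic_series_has_derivative[where q = 2])
  show "(base.cgf_deriv (Suc m) has_field_derivative base.cgf_deriv2 (Suc m) l) (at l)" for m l
    by (rule base.cgf_deriv_has_derivative)
  show "\<bar>base.cgf_deriv2 (Suc m) l\<bar> \<le> real (Suc m) ^ 2" for m l
    by (rule base.abs_cgf_deriv2_le)
  show "summable (\<lambda>m. base.cgf_deriv (Suc m) 0 / 2 ^ (m + 2))"
    by (rule summable_dyadic_bounded[where q = 1]) (use base.abs_cgf_deriv_le[of "Suc _"] in \<open>simp del: of_nat_Suc\<close>)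
qed

lemma deriv2_cal_F_zero:
  "deriv (deriv (cal_F p)) 0 = (\<Sum>m. variance (model_chain (Suc m)) / 2 ^ (m + 2))"
  using DERIV_imp_deriv[OF deriv_cal_F_has_derivative[of 0]] by (simp add: base.cgf_deriv2_zero)

lemma variance_chain_le: "variance (model_chain n) \<le> real n ^ 2"
  using base.abs_cgf_deriv2_le[of n 0] by (simp add: base.cgf_deriv2_zero)

text \<open>A single bond has square 1 and mean \<open>(2 * p - 1) ^ 2\<close>, which is below 1.
  All other variances are nonnegative, so this term alone makes the limiting variance
  positive.\<close>

lemma variance_chain_one_pos: "0 < variance (model_chain 1)"
proof -
  have spin_int: "integrable M (\<sigma> i)" if "1 \<le> i" for i
    using that spin_range[OF that] by (intro integrable_const_bound[where B = 1] spin_measurable AE_I2) fastforce+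
  have spin_mean: "expectation (\<sigma> i) = 2 * p - 1" if "1 \<le> i" for i
  proof -
    have "expectation (\<sigma> i) = (\<Sum>v\<in>{-1, 1}. v * prob {\<omega> \<in> space M. \<sigma> i \<omega> = v})"
      using expectation_finite_range[where f = "\<lambda>v. v", OF spin_measurable[OF that], of "{-1, 1}"] spin_range[OF that] by auto
    then show ?thesis using spin_plus[OF that] spin_minus[OF that] by simp
  qed
  have chain1: "model_chain 1 \<omega> = (\<Prod>i\<in>{1, 2}. \<sigma> i \<omega>)" for \<omega> by (simp add: model_chain_def chain_def)
  have "expectation (model_chain 1) = (\<Prod>i\<in>{1, 2}. expectation (\<sigma> i))"
    unfolding chain1[THEN ext]
    by (rule indep_vars_lebesgue_integral) (auto intro: indep_vars_subset[OF spin_indep] spin_int)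
  then have mean: "expectation (model_chain 1) = (2 * p - 1) ^ 2"
    by (simp add: spin_mean power2_eq_square)
  have "expectation (\<lambda>\<omega>. (model_chain 1 \<omega>)\<^sup>2) = expectation (\<lambda>\<omega>. 1)"
  proof (rule Bochner_Integration.integral_cong)
    fix \<omega> assume "\<omega> \<in> space M"
    then show "(model_chain 1 \<omega>)\<^sup>2 = 1" using spin_range[of 1 \<omega>] spin_range[of 2 \<omega>] unfolding chain1 by auto
  qed simp
  then have sq: "expectation (\<lambda>\<omega>. (model_chain 1 \<omega>)\<^sup>2) = 1" by (simp add: prob_space)
  have "variance (model_chain 1) = 1 - ((2 * p - 1) ^ 2)\<^sup>2"
    using base.integrable_bounded_range[of 1 1] base.integrable_bounded_range[of 1 2] mean sq
    by (subst variance_eq) auto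
  moreover have "(2 * p - 1) ^ 2 < 1" using p by (simp add: abs_square_less_1 abs_less_iff)
  then have "((2 * p - 1) ^ 2)\<^sup>2 < 1" by (subst power_less_one_iff) auto
  ultimately show ?thesis by simp
qed

lemma summable_variance: "summable (\<lambda>m. variance (model_chain (Suc m)) / 2 ^ (m + 2))"
  by (rule summable_dyadic_bounded[where q = 2]) (use variance_chain_le[of "Suc _"] in \<open>simp del: of_nat_Suc\<close>)

lemma deriv2_cal_F_pos: "0 < deriv (deriv (cal_F p)) 0"
  unfolding deriv2_cal_F_zero using variance_chain_one_pos
  by (intro suminf_pos2[where i = 0] summable_variance) auto

theorem ldp_S_sum: "LDP M (\<lambda>N \<omega>. S_sum \<sigma> N \<omega> / real N) (rate_I p)"
proof -
  interpret scaled_cgf_limit M "\<lambda>N \<omega>. S_sum \<sigma> N \<omega> / real N" 1 "cal_F p"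
  proof
    fix N \<omega> assume \<omega>: "\<omega> \<in> space M"
    have "\<bar>S_sum \<sigma> N \<omega>\<bar> \<le> (\<Sum>i=1..N. \<bar>\<sigma> i \<omega> * \<sigma> (2 * i) \<omega>\<bar>)" unfolding S_sum_def by (rule sum_abs)
    also have "\<dots> \<le> (\<Sum>i=1..N. 1)"
    proof (rule sum_mono)
      fix i assume "i \<in> {1..N}"
      then show "\<bar>\<sigma> i \<omega> * \<sigma> (2 * i) \<omega>\<bar> \<le> 1"
        using \<omega> spin_range[of i \<omega>] spin_range[of "2 * i" \<omega>] by (auto simp: abs_mult)
    qed
    finally show "\<bar>S_sum \<sigma> N \<omega> / real N\<bar> \<le> 1" by (simp add: abs_divide divide_le_eq)
  qed (use scaled_cgf_S_sum_limit in auto)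
  have "rate_I p = legendre (cal_F p)" by (intro ext) (simp add: rate_I_def legendre_def)
  moreover have "cal_F p differentiable (at l)" for l
    using cal_F_has_derivative by (auto simp: real_differentiable_def)
  ultimately show ?thesis using gaertner_ellis by simp
qed

end

section \<open>Central limit theorem\<close>

lemma char_normal_density:
  assumes "0 < s"
  shows "char (density lborel (normal_density 0 s)) t = of_real (exp (- (s * t)\<^sup>2 / 2))"
proof -
  interpret std: prob_space std_normal_distribution
    by (rule prob_space_normal_density) simp
  have "distributed std_normal_distribution lborel (\<lambda>x. x) (normal_density 0 1)"
    by (auto simp: distributed_def distr_id2)
  from std.normal_density_affine[OF this, of s 0] assms
  have "distr std_normal_distribution lborel (\<lambda>x. s * x) = density lborel (normal_density 0 s)"
    by (simp add: distributed_def)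
  then have "char (density lborel (normal_density 0 s)) t = char std_normal_distribution (s * t)"
    unfolding char_def by (subst (asm) eq_commute) (simp add: integral_distr mult_ac)
  then show ?thesis by (simp add: char_std_normal_distribution)
qed

lemma abs_exp_minus_linear_le:
  fixes u :: real
  assumes "0 \<le> u"
  shows "\<bar>exp (- u) - (1 - u)\<bar> \<le> u\<^sup>2 / 2"
proof -
  have "exp (- u) \<ge> 1 - u" using exp_ge_add_one_self[of "- u"] by simp
  moreover have "exp (- u) \<le> 1 - u + u\<^sup>2 / 2"
  proof -
    \<comment> \<open>The product equals \<open>1 + u ^ 4 / 4\<close>. Since the second factor is at
      most \<open>exp u\<close>, the first is an upper bound for \<open>exp (- u)\<close>.\<close>
    have "1 \<le> (1 - u + u\<^sup>2 / 2) * (1 + u + u\<^sup>2 / 2)"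
    proof -
      have "(1 - u + u\<^sup>2 / 2) * (1 + u + u\<^sup>2 / 2) = 1 + (u\<^sup>2)\<^sup>2 / 4"
        by (simp add: field_simps power2_eq_square)
      then show ?thesis by simp
    qed
    also have "\<dots> \<le> (1 - u + u\<^sup>2 / 2) * exp u"
    proof (rule mult_left_mono)
      show "1 + u + u\<^sup>2 / 2 \<le> exp u" using assms by (rule exp_lower_Taylor_quadratic)
      have "1 - u + u\<^sup>2 / 2 = ((1 - u)\<^sup>2 + 1) / 2" by (simp add: field_simps power2_eq_square)
      then show "0 \<le> 1 - u + u\<^sup>2 / 2" by (simp only:) simp
    qed
    finally show ?thesis by (simp add: exp_minus divide_simps)
  qed
  ultimately show ?thesis by simp
qed

context bernoulli_spins
begin

text \<open>The centred chain is bounded by \<open>2 * real n\<close>, so the third-order remainder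
  is at most \<open>(2 * real n) ^ 3 / 6\<close> times the cube of \<open>\<bar>s\<bar>\<close>,
  which explains \<open>4 / 3\<close>. The second term is the price of replacing the quadratic
  polynomial by a Gaussian factor, with the variance bounded by the square of
  \<open>n\<close>.\<close>

lemma char_model_chain_approx:
  "cmod (char (distr M borel (\<lambda>\<omega>. model_chain n \<omega> - expectation (model_chain n))) s
      - of_real (exp (- (s\<^sup>2 * variance (model_chain n) / 2))))
    \<le> 4 / 3 * \<bar>s\<bar> ^ 3 * real n ^ 3 + s ^ 4 / 8 * real n ^ 4"
proof -
  define m V where "m = expectation (model_chain n)" and "V = variance (model_chain n)"
  define D where "D \<omega> = model_chain n \<omega> - m" for \<omega>
  have [measurable]: "D \<in> borel_measurable M" unfolding D_def[abs_def] by simp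
  have int: "integrable M (model_chain n)"
    using base.integrable_bounded_range[of n 1] by simp
  have "\<bar>m\<bar> \<le> real n"
    using base.abs_cgf_deriv_le[of n 0] by (simp add: base.cgf_deriv_zero m_def)
  then have D_le: "\<bar>D \<omega>\<bar> \<le> 2 * real n" if "\<omega> \<in> space M" for \<omega>
    using abs_chain_le[OF zero_less_one that, of n] by (simp add: D_def model_chain_def)
  have int_pow: "integrable M (\<lambda>\<omega>. \<bar>D \<omega>\<bar> ^ j)" for j
  proof (rule integrable_const_bound[where B = "(2 * real n) ^ j"])
    show "AE \<omega> in M. norm (\<bar>D \<omega>\<bar> ^ j) \<le> (2 * real n) ^ j"
      using power_mono[OF D_le] by (intro AE_I2) (simp add: power_abs)
  qed simp
  have sq: "integrable M (\<lambda>\<omega>. (D \<omega>)\<^sup>2)" using int_pow[of 2] by simp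
  have mean: "expectation D = 0" unfolding D_def[abs_def] using int by (simp add: m_def prob_space)
  have "cmod (char (distr M borel D) s - (1 - s\<^sup>2 * V / 2))
      \<le> s\<^sup>2 / 6 * expectation (\<lambda>\<omega>. min (6 * (D \<omega>)\<^sup>2) (\<bar>s\<bar> * \<bar>D \<omega>\<bar> ^ 3))"
  proof (rule char_approx3'[OF _ _ sq mean _ refl])
    show "integrable M D" unfolding D_def[abs_def] using int by simp
    show "variance D = V" unfolding mean by (simp add: D_def V_def m_def)
  qed simp
  also have "expectation (\<lambda>\<omega>. min (6 * (D \<omega>)\<^sup>2) (\<bar>s\<bar> * \<bar>D \<omega>\<bar> ^ 3)) \<le> expectation (\<lambda>\<omega>. \<bar>s\<bar> * (2 * real n) ^ 3)"
  proof (rule integral_mono)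
    show "integrable M (\<lambda>\<omega>. min (6 * (D \<omega>)\<^sup>2) (\<bar>s\<bar> * \<bar>D \<omega>\<bar> ^ 3))"
      by (intro integrable_min integrable_mult_right sq int_pow)
    fix \<omega> assume "\<omega> \<in> space M"
    then have "\<bar>s\<bar> * \<bar>D \<omega>\<bar> ^ 3 \<le> \<bar>s\<bar> * (2 * real n) ^ 3"
      by (intro mult_left_mono power_mono D_le) auto
    then show "min (6 * (D \<omega>)\<^sup>2) (\<bar>s\<bar> * \<bar>D \<omega>\<bar> ^ 3) \<le> \<bar>s\<bar> * (2 * real n) ^ 3" by simp
  qed simp
  also have "expectation (\<lambda>\<omega>. \<bar>s\<bar> * (2 * real n) ^ 3) = \<bar>s\<bar> * (2 * real n) ^ 3" by (simp add: prob_space)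
  also have "s\<^sup>2 / 6 * (\<bar>s\<bar> * (2 * real n) ^ 3) = 4 / 3 * \<bar>s\<bar> ^ 3 * real n ^ 3"
  proof -
    have "\<bar>s\<bar> ^ 3 = s\<^sup>2 * \<bar>s\<bar>" by (simp add: power3_eq_cube power2_eq_square)
    then show ?thesis by (simp add: power_mult_distrib)
  qed
  finally have 1: "cmod (char (distr M borel D) s - (1 - s\<^sup>2 * V / 2)) \<le> 4 / 3 * \<bar>s\<bar> ^ 3 * real n ^ 3"
    by (simp add: mult_left_mono)
  have V0: "0 \<le> V" unfolding V_def by (intro integral_nonneg_AE) auto
  define u where "u = s\<^sup>2 * V / 2"
  have u: "0 \<le> u" using V0 by (simp add: u_def)
  have "u \<le> s\<^sup>2 * real n ^ 2 / 2"
    unfolding u_def V_def by (intro divide_right_mono mult_left_mono variance_chain_le) auto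
  then have "u\<^sup>2 \<le> (s\<^sup>2 * real n ^ 2 / 2)\<^sup>2" using u by (intro power_mono)
  also have "\<dots> = s ^ 4 / 4 * real n ^ 4" by (simp add: power_divide power_mult_distrib power_mult[symmetric])
  finally have "\<bar>exp (- u) - (1 - u)\<bar> \<le> s ^ 4 / 8 * real n ^ 4"
    using abs_exp_minus_linear_le[OF u] by simp
  moreover have "complex_of_real (1 - s\<^sup>2 * V / 2) - complex_of_real (exp (- u)) = complex_of_real (- (exp (- u) - (1 - u)))"
    by (simp add: u_def)
  ultimately have 2: "cmod (complex_of_real (1 - s\<^sup>2 * V / 2) - complex_of_real (exp (- u))) \<le> s ^ 4 / 8 * real n ^ 4"
    by (simp only: norm_of_real abs_minus_cancel)
  have "cmod (char (distr M borel D) s - of_real (exp (- u)))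
      \<le> cmod (char (distr M borel D) s - (1 - s\<^sup>2 * V / 2)) + cmod (complex_of_real (1 - s\<^sup>2 * V / 2) - complex_of_real (exp (- u)))"
    by (rule norm_diff_triangle_le[OF order_refl order_refl])
  with 1 2 show ?thesis unfolding D_def[abs_def] u_def V_def m_def by linarith
qed

lemma expectation_S_sum:
  "expectation (S_sum \<sigma> N) = (\<Sum>k\<in>odds_upto N. expectation (model_chain (chain_len N k)))"
proof -
  have "expectation (S_sum \<sigma> N) = expectation (\<lambda>\<omega>. \<Sum>k\<in>odds_upto N. chain k (chain_len N k) \<omega>)"
    by (simp add: S_sum_eq_chains[THEN ext])
  also have "\<dots> = (\<Sum>k\<in>odds_upto N. expectation (chain k (chain_len N k)))"
  proof (rule Bochner_Integration.integral_sum)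
    fix k assume "k \<in> odds_upto N"
    note k = odds_upto_pos[OF this]
    show "integrable M (chain k (chain_len N k))"
      by (rule integrable_const_bound[where B = "real (chain_len N k)"]) (use abs_chain_le[OF k] chain_measurable[OF k] in auto)
  qed
  also have "\<dots> = (\<Sum>k\<in>odds_upto N. expectation (model_chain (chain_len N k)))"
    by (intro sum.cong refl expectation_chain_eq[where f = "\<lambda>x. x"] odds_upto_pos) auto
  finally show ?thesis .
qed

lemma char_normalized_S_sum:
  "char (distr M borel (\<lambda>\<omega>. c * (S_sum \<sigma> N \<omega> - expectation (S_sum \<sigma> N)))) t
    = (\<Prod>k\<in>odds_upto N. char (distr M borel
        (\<lambda>\<omega>. model_chain (chain_len N k) \<omega> - expectation (model_chain (chain_len N k)))) (c * t))"
proof -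
  define m where "m n = expectation (model_chain n)" for n
  have eq: "c * (S_sum \<sigma> N \<omega> - expectation (S_sum \<sigma> N))
      = (\<Sum>k\<in>odds_upto N. c * (chain k (chain_len N k) \<omega> - m (chain_len N k)))" for \<omega>
    unfolding expectation_S_sum S_sum_eq_chains m_def sum_subtractf[symmetric] by (rule sum_distrib_left)
  have "indep_vars (\<lambda>_. borel) (\<lambda>k \<omega>. c * (chain k (chain_len N k) \<omega> - m (chain_len N k))) (odds_upto N)"
    by (rule indep_vars_compose2[OF indep_chains, where Y = "\<lambda>k x. c * (x - m (chain_len N k))"]) auto
  then have "char (distr M borel (\<lambda>\<omega>. c * (S_sum \<sigma> N \<omega> - expectation (S_sum \<sigma> N)))) t
    = (\<Prod>k\<in>odds_upto N. char (distr M borel (\<lambda>\<omega>. c * (chain k (chain_len N k) \<omega> - m (chain_len N k)))) t)"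
    unfolding eq by (rule char_distr_sum)
  also have "\<dots> = (\<Prod>k\<in>odds_upto N. char (distr M borel (\<lambda>\<omega>. model_chain (chain_len N k) \<omega> - m (chain_len N k))) (c * t))"
  proof (rule prod.cong[OF refl])
    fix k assume "k \<in> odds_upto N"
    note k = odds_upto_pos[OF this]
    note [measurable] = chain_measurable[OF k]
    let ?n = "chain_len N k"
    have "char (distr M borel (\<lambda>\<omega>. c * (chain k ?n \<omega> - m ?n))) t
        = expectation (\<lambda>\<omega>. iexp (t * (c * (chain k ?n \<omega> - m ?n))))"
      unfolding char_def by (subst integral_distr) auto
    also have "\<dots> = expectation (\<lambda>\<omega>. iexp (t * (c * (model_chain ?n \<omega> - m ?n))))"
      by (rule expectation_chain_eq[OF k, where f = "\<lambda>x. iexp (t * (c * (x - m ?n)))"]) measurable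
    also have "\<dots> = char (distr M borel (\<lambda>\<omega>. model_chain ?n \<omega> - m ?n)) (c * t)"
      unfolding char_def by (subst integral_distr) (auto simp: mult_ac)
    finally show "char (distr M borel (\<lambda>\<omega>. c * (chain k ?n \<omega> - m ?n))) t
        = char (distr M borel (\<lambda>\<omega>. model_chain ?n \<omega> - m ?n)) (c * t)" .
  qed
  finally show ?thesis by (simp only: m_def)
qed

lemma chain_average_power_tendsto:
  "(\<lambda>N. (\<Sum>k\<in>odds_upto N. real (chain_len N k) ^ q) / real N) \<longlonglongrightarrow> (\<Sum>m. real (Suc m) ^ q / 2 ^ (m + 2))"
  using chain_average_tendsto[where a = "\<lambda>n. real n ^ q"] summable_power_geometric[of q] by simp

theorem clt_S_sum:
  "weak_conv_m
    (\<lambda>N. distr M borel (\<lambda>\<omega>. real N powr (-1/2) * (S_sum \<sigma> N \<omega> - expectation (S_sum \<sigma> N))))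
    (density lborel (normal_density 0 (sqrt (deriv (deriv (cal_F p)) 0))))"
proof (rule levy_continuity)
  define v where "v = deriv (deriv (cal_F p)) 0"
  have v: "0 < v" unfolding v_def by (rule deriv2_cal_F_pos)
  show "real_distribution (distr M borel (\<lambda>\<omega>. real N powr (-1/2) * (S_sum \<sigma> N \<omega> - expectation (S_sum \<sigma> N))))" for N
    by (rule real_distribution_distr) simp
  show "real_distribution (density lborel (normal_density 0 (sqrt (deriv (deriv (cal_F p)) 0))))"
    using prob_space_normal_density[of "sqrt v" 0] v
    by (simp add: v_def real_distribution_def real_distribution_axioms_def)
  fix t
  define c where "c N = real N powr (-1/2)" for N
  have c2: "c N ^ 2 = 1 / real N" if "0 < N" for N
    using that by (simp add: c_def power2_eq_square powr_add[symmetric] powr_minus_divide)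
  have c_lim: "c \<longlonglongrightarrow> 0" unfolding c_def by real_asymp
  define V where "V n = variance (model_chain n)" for n
  define A where "A q N = (\<Sum>k\<in>odds_upto N. real (chain_len N k) ^ q) / real N" for q N
  \<comment> \<open>The characteristic function of a sum of independent centred Gaussians with the
    variances of the scaled chains. All factors on both sides have modulus at most 1, so the
    distance of the two products is at most the sum of the distances of their factors.\<close>
  define \<psi> where "\<psi> N = (\<Prod>k\<in>odds_upto N. complex_of_real (exp (- ((c N * t)\<^sup>2 * V (chain_len N k) / 2))))" for N
  let ?\<phi> = "\<lambda>N. char (distr M borel (\<lambda>\<omega>. c N * (S_sum \<sigma> N \<omega> - expectation (S_sum \<sigma> N)))) t"
  have V0: "0 \<le> V n" for n unfolding V_def by (intro integral_nonneg_AE) auto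
  have bound: "cmod (?\<phi> N - \<psi> N) \<le> 4 / 3 * \<bar>t\<bar> ^ 3 * A 3 N * c N + t ^ 4 / 8 * A 4 N * (c N)\<^sup>2" if N: "0 < N" for N
  proof -
    have "cmod (?\<phi> N - \<psi> N) \<le> (\<Sum>k\<in>odds_upto N. cmod (char (distr M borel
        (\<lambda>\<omega>. model_chain (chain_len N k) \<omega> - expectation (model_chain (chain_len N k)))) (c N * t)
        - complex_of_real (exp (- ((c N * t)\<^sup>2 * V (chain_len N k) / 2)))))"
      unfolding char_normalized_S_sum \<psi>_def
    proof (rule norm_prod_diff)
      fix k
      show "cmod (char (distr M borel (\<lambda>\<omega>. model_chain (chain_len N k) \<omega> - expectation (model_chain (chain_len N k)))) (c N * t)) \<le> 1"
        by (intro real_distribution.cmod_char_le_1 real_distribution_distr) simp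
      show "cmod (complex_of_real (exp (- ((c N * t)\<^sup>2 * V (chain_len N k) / 2)))) \<le> 1"
        unfolding norm_of_real using V0[of "chain_len N k"] by simp
    qed
    also have "\<dots> \<le> (\<Sum>k\<in>odds_upto N. 4 / 3 * \<bar>c N * t\<bar> ^ 3 * real (chain_len N k) ^ 3
        + (c N * t) ^ 4 / 8 * real (chain_len N k) ^ 4)"
      unfolding V_def by (intro sum_mono char_model_chain_approx)
    also have "\<dots> = 4 / 3 * \<bar>c N * t\<bar> ^ 3 * (real N * A 3 N) + (c N * t) ^ 4 / 8 * (real N * A 4 N)"
    proof -
      have "real N * A q N = (\<Sum>k\<in>odds_upto N. real (chain_len N k) ^ q)" for q
        using N by (simp add: A_def)
      then show ?thesis by (simp only: sum.distrib sum_distrib_left)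
    qed
    \<comment> \<open>One factor \<open>c N ^ 2 = 1 / real N\<close> is split off to cancel the
      number of sites. What is left over, \<open>c N\<close> or its square, drives the error to
      0.\<close>
    also have "\<bar>c N * t\<bar> ^ 3 = \<bar>t\<bar> ^ 3 * c N * (c N)\<^sup>2"
      by (simp add: abs_mult power_mult_distrib c_def power2_eq_square power3_eq_cube)
    also have "(c N * t) ^ 4 = t ^ 4 * (c N)\<^sup>2 * (c N)\<^sup>2"
      by (simp add: power_mult_distrib power2_eq_square power4_eq_xxxx)
    finally show ?thesis using N by (simp add: c2 field_simps)
  qed
  have "(\<lambda>N. 4 / 3 * \<bar>t\<bar> ^ 3 * A 3 N * c N + t ^ 4 / 8 * A 4 N * (c N)\<^sup>2)
      \<longlonglongrightarrow> 4 / 3 * \<bar>t\<bar> ^ 3 * (\<Sum>m. real (Suc m) ^ 3 / 2 ^ (m + 2)) * 0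
        + t ^ 4 / 8 * (\<Sum>m. real (Suc m) ^ 4 / 2 ^ (m + 2)) * 0\<^sup>2"
    unfolding A_def by (intro tendsto_intros chain_average_power_tendsto c_lim)
  then have "(\<lambda>N. 4 / 3 * \<bar>t\<bar> ^ 3 * A 3 N * c N + t ^ 4 / 8 * A 4 N * (c N)\<^sup>2) \<longlonglongrightarrow> 0" by simp
  then have diff: "(\<lambda>N. ?\<phi> N - \<psi> N) \<longlonglongrightarrow> 0"
    \<comment> \<open>The estimate holds from \<open>N = 1\<close> on, where
      \<open>c N ^ 2 = 1 / real N\<close> is valid.\<close>
    by (rule Lim_null_comparison[rotated]) (use bound in \<open>auto simp: eventually_sequentially intro!: exI[of _ 1]\<close>)
  have "(\<lambda>N. (\<Sum>k\<in>odds_upto N. V (chain_len N k)) / real N) \<longlonglongrightarrow> v"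
  proof -
    have "summable (\<lambda>m. \<bar>V (Suc m)\<bar> / 2 ^ m)"
      using summable_mult[OF summable_variance, of 4] V0 by (simp add: V_def[symmetric] field_simps)
    from chain_average_tendsto[OF this] show ?thesis by (simp add: v_def deriv2_cal_F_zero V_def)
  qed
  then have "(\<lambda>N. exp (- (t\<^sup>2 * ((\<Sum>k\<in>odds_upto N. V (chain_len N k)) / real N) / 2))) \<longlonglongrightarrow> exp (- (t\<^sup>2 * v / 2))"
    by (intro tendsto_intros) auto
  then have "(\<lambda>N. complex_of_real (exp (- (t\<^sup>2 * ((\<Sum>k\<in>odds_upto N. V (chain_len N k)) / real N) / 2))))
      \<longlonglongrightarrow> of_real (exp (- (t\<^sup>2 * v / 2)))"
    by (rule tendsto_of_real)
  moreover have "eventually (\<lambda>N. complex_of_real (exp (- (t\<^sup>2 * ((\<Sum>k\<in>odds_upto N. V (chain_len N k)) / real N) / 2))) = \<psi> N) sequentially"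
    using eventually_gt_at_top[of 0]
  proof eventually_elim
    case (elim N)
    have "- (t\<^sup>2 * ((\<Sum>k\<in>odds_upto N. V (chain_len N k)) / real N) / 2)
        = (\<Sum>k\<in>odds_upto N. - ((c N * t)\<^sup>2 * V (chain_len N k) / 2))"
      using elim by (simp add: power_mult_distrib c2 sum_negf sum_divide_distrib[symmetric] sum_distrib_left[symmetric])
    then show ?case unfolding \<psi>_def by (simp add: exp_sum[symmetric] of_real_prod[symmetric] del: of_real_prod)
  qed
  ultimately have "\<psi> \<longlonglongrightarrow> of_real (exp (- (t\<^sup>2 * v / 2)))" by (rule Lim_transform_eventually)
  from tendsto_add[OF diff this]
  have "?\<phi> \<longlonglongrightarrow> of_real (exp (- (t\<^sup>2 * v / 2)))" by simp
  moreover have "char (density lborel (normal_density 0 (sqrt v))) t = of_real (exp (- (t\<^sup>2 * v / 2)))"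
    using v by (simp add: char_normal_density power_mult_distrib mult.commute)
  ultimately show "(\<lambda>N. char (distr M borel (\<lambda>\<omega>. real N powr (-1/2) * (S_sum \<sigma> N \<omega> - expectation (S_sum \<sigma> N)))) t)
      \<longlonglongrightarrow> char (density lborel (normal_density 0 (sqrt (deriv (deriv (cal_F p)) 0)))) t"
    by (simp only: c_def v_def)
qed

end

text \<open>\<open>deriv\<close> returns an arbitrary value where no derivative exists. The two
  differentiability conjuncts guarantee that \<open>deriv (deriv (cal_F p)) 0\<close> is a genuine
  second derivative.\<close>

theorem theorem4p1:
  fixes p :: real and M :: "'a measure" and \<sigma> :: "nat \<Rightarrow> 'a \<Rightarrow> real"
  assumes p: "0 < p" "p < 1"
    and M: "prob_space M"
    and range: "\<And>i \<omega>. 1 \<le> i \<Longrightarrow> \<omega> \<in> space M \<Longrightarrow> \<sigma> i \<omega> \<in> {-1, 1}"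
    and indep: "prob_space.indep_vars M (\<lambda>_. borel) \<sigma> {1..}"
    and prob_plus: "\<And>i. 1 \<le> i \<Longrightarrow> measure M {\<omega> \<in> space M. \<sigma> i \<omega> = 1} = p"
    and prob_minus: "\<And>i. 1 \<le> i \<Longrightarrow> measure M {\<omega> \<in> space M. \<sigma> i \<omega> = -1} = 1 - p"
  shows "LDP M (\<lambda>N \<omega>. S_sum \<sigma> N \<omega> / real N) (rate_I p)
    \<and> (\<forall>\<^sub>F l in nhds 0. cal_F p differentiable (at l))
    \<and> deriv (cal_F p) differentiable (at 0)
    \<and> weak_conv_m
        (\<lambda>N. distr M borel
           (\<lambda>\<omega>. real N powr (-1/2) * (S_sum \<sigma> N \<omega> - (\<integral>\<omega>'. S_sum \<sigma> N \<omega>' \<partial>M))))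
        (density lborel (normal_density 0 (sqrt (deriv (deriv (cal_F p)) 0))))
    \<and> deriv (deriv (cal_F p)) 0 > 0"
proof -
  interpret bernoulli_spins M p \<sigma>
    using M p range indep prob_plus prob_minus by (intro bernoulli_spins.intro bernoulli_spins_axioms.intro)
  have "cal_F p differentiable (at l)" for l
    using cal_F_has_derivative by (auto simp: real_differentiable_def)
  moreover have "deriv (cal_F p) differentiable (at 0)"
    using deriv_cal_F_has_derivative by (auto simp: real_differentiable_def)
  ultimately show ?thesis
    using ldp_S_sum clt_S_sum deriv2_cal_F_pos by auto
qed

end
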